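(* Let $\alpha>0$, $1\le p<\infty$ and $1\le q,s\le\infty$. Then: (1) If $T\in\mathcal{N}(f_\alpha^\infty,F_\alpha^s)$, then $\widetilde{T}\in L^r(\mathbb{C},dA)$ for all $1\le r\le\infty$. (2) If $T\in\mathcal{N}(F_\alpha^p,F_\alpha^q)$ and $p\le q$, then $\widetilde{T}\in L^r(\mathbb{C},dA)$ for all $\left(\frac{1}{p'}+\frac{1}{q}\right)^{-1}\le r\le\infty$. (3) If $T\in\mathcal{N}(F_\alpha^p,F_\alpha^q)$ and $p>q$, then $\widetilde{T}\in L^r(\mathbb{C},dA)$ for all $1\le r\le\infty$. Moreover, in each case and for each such $r$, $\|\widetilde{T}\|_{L^r}\lesssim\|T\|_{\mathcal{N}}$, where $\|T\|_{\mathcal N}$ is the nuclear norm of $T$ in the respective space.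
   Context: Let $dA$ be Lebesgue area measure on $\mathbb{C}$. For $1\le p<\infty$, $F_\alpha^p$ is the Banach space of entire functions $f$ with $\|f\|_{\alpha,p}^p=\frac{p\alpha}{2\pi}\int_{\mathbb{C}}|f(z)e^{-\frac{\alpha}{2}|z|^2}|^p\,dA(z)<\infty$; $F_\alpha^\infty$ is the Banach space of entire functions with $\|f\|_{\alpha,\infty}=\sup_{z}|f(z)|e^{-\alpha|z|^2/2}<\infty$; $f_\alpha^\infty$ is the closed subspace of $F_\alpha^\infty$ of those $f$ with $\lim_{|z|\to\infty}f(z)e^{-\frac{\alpha}{2}|z|^2}=0$. $p'$ is the conjugate exponent, $\frac1p+\frac1{p'}=1$; conventions $1/\infty=0$ and $0^{-1}=\infty$. Write $\langle f,g\rangle_{F_\alpha^2}=\frac{\alpha}{\pi}\int_{\mathbb{C}}f(z)\overline{g(z)}e^{-\alpha|z|^2}dA(z)$ and $k_z(w)=e^{\alpha\overline{z}w-\frac{\alpha}{2}|z|^2}$. The Berezin transform of an operator $T$ is $\widetilde{T}(z)=\langle Tk_z,k_z\rangle_{F_\alpha^2}$, $z\in\mathbb{C}$. For Banach spaces $X,Y$, $\mathcal{N}(X,Y)$ is the set of bounded linear $T:X\to Y$ of the form $Tx=\sum_{j\ge1}x_j'(x)y_j$ with $x_j'\in X'$, $y_j\in Y$, $\sum_j\|x_j'\|_{X'}\|y_j\|_Y<\infty$; $\|T\|_{\mathcal N}$ is the infimum of $\sum_j\|x_j'\|\|y_j\|$ over all such representations. $A\lesssim B$ means $A\le cB$ for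 a positive constant $c$ (here independent of $T$). *)

theory Defs
  imports "HOL-Complex_Analysis.Complex_Analysis" "HOL-Probability.Essential_Supremum"
begin

text \<open>
  Exponents range over \<^typ>\<open>ennreal\<close>, where \<open>1 / top = 0\<close> and \<open>inverse 0 = top\<close>. Area measure on
  the complex plane is \<^const>\<open>lborel\<close>.
\<close>

text \<open>
  A normed space of complex-valued functions is given by its carrier, a linear subspace under the
  pointwise operations, and its norm, which is meaningful on the carrier only. Carriers are needed
  because the spaces below depend on the term parameters \<open>\<alpha>\<close> and \<open>p\<close>.
\<close>

record 'a fun_space =
  fs_carrier :: "('a \<Rightarrow> complex) set"
  fs_norm :: "('a \<Rightarrow> complex) \<Rightarrow> real"

definition gauss_weighted :: "real \<Rightarrow> (complex \<Rightarrow> complex) \<Rightarrow> complex \<Rightarrow> complex" where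
  "gauss_weighted \<alpha> f z = f z * complex_of_real (exp (- (\<alpha> / 2) * (cmod z)\<^sup>2))"

definition fock :: "real \<Rightarrow> ennreal \<Rightarrow> complex fun_space" where
  "fock \<alpha> p =
    (if p = top then
       \<lparr> fs_carrier = {f. f holomorphic_on UNIV \<and> bdd_above (range (\<lambda>z. cmod (gauss_weighted \<alpha> f z)))},
         fs_norm = (\<lambda>f. SUP z. cmod (gauss_weighted \<alpha> f z)) \<rparr>
     else
       \<lparr> fs_carrier = {f. f holomorphic_on UNIV \<and>
             integrable lborel (\<lambda>z. cmod (gauss_weighted \<alpha> f z) powr enn2real p)},
         fs_norm = (\<lambda>f. (enn2real p * \<alpha> / (2 * pi) *
             (\<integral>z. cmod (gauss_weighted \<alpha> f z) powr enn2real p \<partial>lborel)) powr (1 / enn2real p)) \<rparr>)"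

definition little_fock :: "real \<Rightarrow> complex fun_space" where
  "little_fock \<alpha> =
    \<lparr> fs_carrier = {f \<in> fs_carrier (fock \<alpha> top). (gauss_weighted \<alpha> f \<longlongrightarrow> 0) at_infinity},
      fs_norm = fs_norm (fock \<alpha> top) \<rparr>"

text \<open>
  Functionals and operators are total HOL functions; only their values on the carrier of the
  domain are constrained or used.
\<close>

definition dual_space :: "'a fun_space \<Rightarrow> (('a \<Rightarrow> complex) \<Rightarrow> complex) set" where
  "dual_space X = {\<phi>.
     (\<forall>f\<in>fs_carrier X. \<forall>g\<in>fs_carrier X. \<phi> (\<lambda>w. f w + g w) = \<phi> f + \<phi> g) \<and>
     (\<forall>a. \<forall>f\<in>fs_carrier X. \<phi> (\<lambda>w. a * f w) = a * \<phi> f) \<and>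
     (\<exists>C. \<forall>f\<in>fs_carrier X. cmod (\<phi> f) \<le> C * fs_norm X f)}"

definition dual_norm :: "'a fun_space \<Rightarrow> (('a \<Rightarrow> complex) \<Rightarrow> complex) \<Rightarrow> real" where
  "dual_norm X \<phi> = (SUP f\<in>{f \<in> fs_carrier X. fs_norm X f \<le> 1}. cmod (\<phi> f))"

definition bounded_ops ::
  "'a fun_space \<Rightarrow> 'b fun_space \<Rightarrow> (('a \<Rightarrow> complex) \<Rightarrow> 'b \<Rightarrow> complex) set" where
  "bounded_ops X Y = {T.
     (\<forall>f\<in>fs_carrier X. T f \<in> fs_carrier Y) \<and>
     (\<forall>f\<in>fs_carrier X. \<forall>g\<in>fs_carrier X. T (\<lambda>w. f w + g w) = (\<lambda>w. T f w + T g w)) \<and>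
     (\<forall>a. \<forall>f\<in>fs_carrier X. T (\<lambda>w. a * f w) = (\<lambda>w. a * T f w)) \<and>
     (\<exists>C. \<forall>f\<in>fs_carrier X. fs_norm Y (T f) \<le> C * fs_norm X f)}"

text \<open>The series representing \<open>T f\<close> converges in the norm of \<open>Y\<close>.\<close>

definition nuclear_rep ::
  "'a fun_space \<Rightarrow> 'b fun_space \<Rightarrow> (('a \<Rightarrow> complex) \<Rightarrow> 'b \<Rightarrow> complex) \<Rightarrow>
   (nat \<Rightarrow> ('a \<Rightarrow> complex) \<Rightarrow> complex) \<Rightarrow> (nat \<Rightarrow> 'b \<Rightarrow> complex) \<Rightarrow> bool" where
  "nuclear_rep X Y T \<phi> y \<longleftrightarrow>
     (\<forall>j. \<phi> j \<in> dual_space X) \<and> (\<forall>j. y j \<in> fs_carrier Y) \<and>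
     summable (\<lambda>j. dual_norm X (\<phi> j) * fs_norm Y (y j)) \<and>
     (\<forall>f\<in>fs_carrier X.
        (\<lambda>n. fs_norm Y (\<lambda>w. T f w - (\<Sum>j<n. \<phi> j f * y j w))) \<longlonglongrightarrow> 0)"

definition nuclear_ops ::
  "'a fun_space \<Rightarrow> 'b fun_space \<Rightarrow> (('a \<Rightarrow> complex) \<Rightarrow> 'b \<Rightarrow> complex) set" where
  "nuclear_ops X Y = {T \<in> bounded_ops X Y. \<exists>\<phi> y. nuclear_rep X Y T \<phi> y}"

definition nuclear_norm ::
  "'a fun_space \<Rightarrow> 'b fun_space \<Rightarrow> (('a \<Rightarrow> complex) \<Rightarrow> 'b \<Rightarrow> complex) \<Rightarrow> real" where
  "nuclear_norm X Y T =
     Inf {(\<Sum>j. dual_norm X (\<phi> j) * fs_norm Y (y j)) | \<phi> y. nuclear_rep X Y T \<phi> y}"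

definition fock_inner :: "real \<Rightarrow> (complex \<Rightarrow> complex) \<Rightarrow> (complex \<Rightarrow> complex) \<Rightarrow> complex" where
  "fock_inner \<alpha> f g = complex_of_real (\<alpha> / pi) *
     (\<integral>z. f z * cnj (g z) * complex_of_real (exp (- \<alpha> * (cmod z)\<^sup>2)) \<partial>lborel)"

definition fock_kernel :: "real \<Rightarrow> complex \<Rightarrow> complex \<Rightarrow> complex" where
  "fock_kernel \<alpha> z w =
     exp (complex_of_real \<alpha> * cnj z * w - complex_of_real (\<alpha> / 2 * (cmod z)\<^sup>2))"

definition berezin ::
  "real \<Rightarrow> ((complex \<Rightarrow> complex) \<Rightarrow> complex \<Rightarrow> complex) \<Rightarrow> complex \<Rightarrow> complex" where
  "berezin \<alpha> T z = fock_inner \<alpha> (T (fock_kernel \<alpha> z)) (fock_kernel \<alpha> z)"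

definition Lr_space :: "ennreal \<Rightarrow> (complex \<Rightarrow> complex) set" where
  "Lr_space r = {f \<in> borel_measurable lborel.
     if r = top then esssup lborel (\<lambda>z. ennreal (cmod (f z))) < top
     else integrable lborel (\<lambda>z. cmod (f z) powr enn2real r)}"

definition Lr_norm :: "ennreal \<Rightarrow> (complex \<Rightarrow> complex) \<Rightarrow> real" where
  "Lr_norm r f =
     (if r = top then enn2real (esssup lborel (\<lambda>z. ennreal (cmod (f z))))
      else (\<integral>z. cmod (f z) powr enn2real r \<partial>lborel) powr (1 / enn2real r))"

end

theory Submission
  imports Defs "HOL-Probability.Distributions"
begin

text \<open>
  Write \<open>f\<^sup>\<sharp>(z) = f(z) e\<^bsup>- \<alpha>|z|\<^sup>2/2\<^esup>\<close>. The reproducing formula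
  \<open>\<langle>f, k\<^sub>z\<rangle> = f\<^sup>\<sharp>(z)\<close> turns a nuclear representation \<open>T f = \<Sum>\<^sub>j \<phi>\<^sub>j(f) y\<^sub>j\<close> into

  \<open>T\<^sup>~(z) = \<Sum>\<^sub>j \<phi>\<^sub>j(k\<^sub>z) y\<^sub>j\<^sup>\<sharp>(z)\<close>,

  so it is enough to estimate the two factors of each term and to add up. The second factor is
  bounded and, if \<open>y\<^sub>j \<in> F\<^sup>q\<close>, it lies in \<open>L\<^sup>q\<close> by definition of the norm; the
  pointwise bound comes from the reproducing formula itself. The first factor is bounded and lies
  in \<open>L\<^bsup>p'\<^esup>\<close> for \<open>\<phi>\<^sub>j \<in> (F\<^sup>p)'\<close>, and in \<open>L\<^sup>1\<close> for \<open>\<phi>\<^sub>j \<in> (f\<^sup>\<infinity>)'\<close>. Hoelder's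
  inequality then puts the product in \<open>L\<^sup>r\<close> as soon as \<open>1/r \<le> 1/p' + 1/q\<close> (with \<open>p' = 1\<close>
  in the case of \<open>f\<^sup>\<infinity>\<close>), and this single condition covers all three cases: it reads
  \<open>r \<ge> (1/p' + 1/q)\<^sup>-\<^sup>1\<close> when \<open>p \<le> q\<close>, and when \<open>p > q\<close>, or for \<open>f\<^sup>\<infinity>\<close>, the right-hand
  side is at least 1, so that every \<open>r \<ge> 1\<close> is allowed.

  The estimate of \<open>\<phi>(k\<^sub>z)\<close> is obtained by testing \<open>\<phi>\<close> on finite sums of
  kernels. Cut the plane into unit cells and pick in each cell \<open>i\<close> a point \<open>z\<^sub>i\<close> where \<open>|\<phi>(k\<^sub>z)|\<close> is largest. Since \<open>|k\<^sub>z\<^sup>\<sharp>(w)| = e\<^bsup>- \<alpha>|w - z|\<^sup>2/2\<^esup>\<close>,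
  the kernels at the \<open>z\<^sub>i\<close> have bounded overlap (\<open>gaussian_sum_bound\<close>), and convexity of \<open>x\<^sup>p\<close> gives
  \<open>\<parallel>\<Sum>\<^sub>i c\<^sub>i k\<^bsub>z\<^sub>i\<^esub>\<parallel> \<le> C \<parallel>c\<parallel>\<^bsub>\<ell>\<^sup>p\<^esub>\<close> for every finite sum
  (\<open>fock_kernel_sum_norm\<close>). Applying \<open>\<phi>\<close> and choosing \<open>c\<close> as in the duality of \<open>\<ell>\<^sup>p\<close> and
  \<open>\<ell>\<^bsup>p'\<^esup>\<close> bounds \<open>\<Sum>\<^sub>i |\<phi>(k\<^bsub>z\<^sub>i\<^esub>)|\<^bsup>p'\<^esup>\<close>, which dominates the integral of
  \<open>|\<phi>(k\<^sub>z)|\<^bsup>p'\<^esup>\<close> (\<open>fock_dual_Lp\<close>, \<open>little_fock_dual_L1\<close>).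

  The reproducing formula reduces to the Gaussian mean value property of entire functions, which
  is a consequence of rotation invariance: the Gaussian integral of \<open>f\<close> does not change when \<open>f\<close> is
  replaced by a rotated copy, and the average of all rotated copies is the constant \<open>f(0)\<close> by
  Cauchy's integral formula.
\<close>

section \<open>Area measure on the complex plane\<close>

lemma measurable_Complex [measurable]: "(\<lambda>(x, y). Complex x y) \<in> borel_measurable (borel \<Otimes>\<^sub>M borel)"
  unfolding Complex_eq by measurable

lemma lborel_complex_eq_distr:
  "lborel = distr (lborel \<Otimes>\<^sub>M lborel) borel (\<lambda>(x, y). Complex x y)"
proof (rule lborel_eqI)
  fix l u :: complex
  assume le: "\<And>b. b \<in> Basis \<Longrightarrow> l \<bullet> b \<le> u \<bullet> b"
  then have le': "Re l \<le> Re u" "Im l \<le> Im u"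
    using le[of 1] le[of \<i>] by (auto simp: Basis_complex_def)
  have "(\<lambda>(x, y). Complex x y) -` box l u \<inter> space (lborel \<Otimes>\<^sub>M lborel)
      = {Re l<..<Re u} \<times> {Im l<..<Im u}"
    by (auto simp: box_def Basis_complex_def space_pair_measure)
  then have "emeasure (distr (lborel \<Otimes>\<^sub>M lborel) borel (\<lambda>(x, y). Complex x y)) (box l u)
      = emeasure (lborel \<Otimes>\<^sub>M lborel) ({Re l<..<Re u} \<times> {Im l<..<Im u})"
    by (subst emeasure_distr) auto
  also have "\<dots> = ennreal (Re u - Re l) * ennreal (Im u - Im l)"
    by (subst lborel.emeasure_pair_measure_Times) (use le' in auto)
  also have "\<dots> = (\<Prod>b\<in>Basis. (u - l) \<bullet> b)"
    using le' by (simp add: Basis_complex_def ennreal_mult)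
  finally show "emeasure (distr (lborel \<Otimes>\<^sub>M lborel) borel (\<lambda>(x, y). Complex x y)) (box l u)
      = ennreal (\<Prod>b\<in>Basis. (u - l) \<bullet> b)" .
qed simp

lemma nn_integral_complex_x:
  assumes [measurable]: "f \<in> borel_measurable borel"
  shows "(\<integral>\<^sup>+z. f z \<partial>lborel) = (\<integral>\<^sup>+y. \<integral>\<^sup>+x. f (Complex x y) \<partial>lborel \<partial>lborel)"
proof -
  have "(\<integral>\<^sup>+z. f z \<partial>lborel) = (\<integral>\<^sup>+p. f (case p of (x, y) \<Rightarrow> Complex x y) \<partial>(lborel \<Otimes>\<^sub>M lborel))"
    by (subst lborel_complex_eq_distr, subst nn_integral_distr) auto
  also have "\<dots> = (\<integral>\<^sup>+y. \<integral>\<^sup>+x. f (Complex x y) \<partial>lborel \<partial>lborel)"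
    by (subst lborel_pair.nn_integral_snd [symmetric]) auto
  finally show ?thesis .
qed

lemma nn_integral_complex_y:
  assumes [measurable]: "f \<in> borel_measurable borel"
  shows "(\<integral>\<^sup>+z. f z \<partial>lborel) = (\<integral>\<^sup>+x. \<integral>\<^sup>+y. f (Complex x y) \<partial>lborel \<partial>lborel)"
proof -
  have "(\<integral>\<^sup>+z. f z \<partial>lborel) = (\<integral>\<^sup>+p. f (case p of (x, y) \<Rightarrow> Complex x y) \<partial>(lborel \<Otimes>\<^sub>M lborel))"
    by (subst lborel_complex_eq_distr, subst nn_integral_distr) auto
  also have "\<dots> = (\<integral>\<^sup>+x. \<integral>\<^sup>+y. f (Complex x y) \<partial>lborel \<partial>lborel)"
    by (subst lborel.nn_integral_fst [symmetric]) auto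
  finally show ?thesis .
qed

lemma nn_integral_lborel_translate:
  fixes c :: "'a::euclidean_space"
  assumes "f \<in> borel_measurable borel"
  shows "(\<integral>\<^sup>+x. f (c + x) \<partial>lborel) = (\<integral>\<^sup>+x. f x \<partial>lborel)"
  by (subst (2) lborel_distr_plus [of c, symmetric], subst nn_integral_distr) (use assms in auto)

text \<open>
  Shears preserve area because on each horizontal (or vertical) line they act as a translation.
  They are used to build rotations.
\<close>

lemma nn_integral_shear_x:
  assumes [measurable]: "f \<in> borel_measurable borel"
  shows "(\<integral>\<^sup>+z. f (Complex (Re z + t * Im z) (Im z)) \<partial>lborel) = (\<integral>\<^sup>+z. f z \<partial>lborel)"
proof -
  have "(\<integral>\<^sup>+z. f (Complex (Re z + t * Im z) (Im z)) \<partial>lborel)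
      = (\<integral>\<^sup>+y. \<integral>\<^sup>+x. f (Complex (t * y + x) y) \<partial>lborel \<partial>lborel)"
    by (subst nn_integral_complex_x) (auto simp: Complex_eq add.commute)
  also have "\<dots> = (\<integral>\<^sup>+y. \<integral>\<^sup>+x. f (Complex x y) \<partial>lborel \<partial>lborel)"
  proof (rule nn_integral_cong)
    fix y :: real
    show "(\<integral>\<^sup>+x. f (Complex (t * y + x) y) \<partial>lborel) = (\<integral>\<^sup>+x. f (Complex x y) \<partial>lborel)"
      using nn_integral_lborel_translate[of "\<lambda>x. f (Complex x y)" "t * y"] by (simp add: Complex_eq)
  qed
  finally show ?thesis by (simp add: nn_integral_complex_x)
qed

lemma nn_integral_shear_y:
  assumes [measurable]: "f \<in> borel_measurable borel"
  shows "(\<integral>\<^sup>+z. f (Complex (Re z) (Im z + t * Re z)) \<partial>lborel) = (\<integral>\<^sup>+z. f z \<partial>lborel)"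
proof -
  have "(\<integral>\<^sup>+z. f (Complex (Re z) (Im z + t * Re z)) \<partial>lborel)
      = (\<integral>\<^sup>+x. \<integral>\<^sup>+y. f (Complex x (t * x + y)) \<partial>lborel \<partial>lborel)"
    by (subst nn_integral_complex_y) (auto simp: Complex_eq add.commute)
  also have "\<dots> = (\<integral>\<^sup>+x. \<integral>\<^sup>+y. f (Complex x y) \<partial>lborel \<partial>lborel)"
  proof (rule nn_integral_cong)
    fix x :: real
    show "(\<integral>\<^sup>+y. f (Complex x (t * x + y)) \<partial>lborel) = (\<integral>\<^sup>+y. f (Complex x y) \<partial>lborel)"
      using nn_integral_lborel_translate[of "\<lambda>y. f (Complex x y)" "t * x"] by (simp add: Complex_eq)
  qed
  finally show ?thesis by (simp add: nn_integral_complex_y)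
qed

text \<open>
  A rotation by an angle that is not a multiple of \<open>\<pi>\<close> is a product of three shears.
\<close>

lemma nn_integral_rotate_nonreal:
  fixes c :: complex
  assumes [measurable]: "f \<in> borel_measurable borel" and c: "cmod c = 1" "Im c \<noteq> 0"
  shows "(\<integral>\<^sup>+z. f (c * z) \<partial>lborel) = (\<integral>\<^sup>+z. f z \<partial>lborel)"
proof -
  \<comment> \<open>For \<open>c = cos \<theta> + i sin \<theta>\<close> this is \<open>- tan (\<theta>/2)\<close>.\<close>
  define s where "s = (Re c - 1) / Im c"
  define S where "S = (\<lambda>z. Complex (Re z + s * Im z) (Im z))"
  define U where "U = (\<lambda>z. Complex (Re z) (Im z + Im c * Re z))"
  have [measurable]: "S \<in> borel_measurable borel" "U \<in> borel_measurable borel"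
    unfolding S_def U_def Complex_eq by measurable
  have n: "(Re c)\<^sup>2 + (Im c)\<^sup>2 = 1"
    using c by (simp add: cmod_def)
  have e1: "s * Im c = Re c - 1"
    using c by (simp add: s_def)
  have "Im c * (s * (1 + Re c)) = (s * Im c) * (1 + Re c)"
    by simp
  also have "\<dots> = Im c * (- Im c)"
    unfolding e1 using n by (simp add: algebra_simps power2_eq_square)
  finally have "Im c * (s * (1 + Re c)) = Im c * (- Im c)" .
  then have e2: "s + s * Re c = - Im c"
    using c(2) by (simp only: mult_cancel_left) (simp add: algebra_simps)
  have eq: "c * z = S (U (S z))" for z
  proof (rule complex_eqI)
    have "Re (S (U (S z))) = (1 + s * Im c) * Re z + (s + s * (1 + s * Im c)) * Im z"
      by (simp add: S_def U_def algebra_simps)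
    then show "Re (c * z) = Re (S (U (S z)))"
      by (simp add: e1 e2)
    have "Im (S (U (S z))) = Im c * Re z + (1 + s * Im c) * Im z"
      by (simp add: S_def U_def algebra_simps)
    then show "Im (c * z) = Im (S (U (S z)))"
      by (simp add: e1)
  qed
  have "(\<integral>\<^sup>+z. f (c * z) \<partial>lborel) = (\<integral>\<^sup>+z. f (S (U (S z))) \<partial>lborel)"
    by (simp add: eq)
  also have "\<dots> = (\<integral>\<^sup>+z. f (S (U z)) \<partial>lborel)"
    using nn_integral_shear_x[of "\<lambda>z. f (S (U z))" s] by (simp add: S_def)
  also have "\<dots> = (\<integral>\<^sup>+z. f (S z) \<partial>lborel)"
    using nn_integral_shear_y[of "\<lambda>z. f (S z)" "Im c"] by (simp add: U_def)
  also have "\<dots> = (\<integral>\<^sup>+z. f z \<partial>lborel)"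
    using nn_integral_shear_x[of f s] by (simp add: S_def)
  finally show ?thesis .
qed

lemma nn_integral_rotate:
  fixes c :: complex
  assumes [measurable]: "f \<in> borel_measurable borel" and c: "cmod c = 1"
  shows "(\<integral>\<^sup>+z. f (c * z) \<partial>lborel) = (\<integral>\<^sup>+z. f z \<partial>lborel)"
proof (cases "Im c = 0")
  case False
  then show ?thesis using nn_integral_rotate_nonreal assms by blast
next
  case True
  then have "c = 1 \<or> c = -1"
    using c by (auto simp: cmod_def complex_eq_iff abs_if split: if_splits)
  then show ?thesis
  proof
    assume "c = -1"
    \<comment> \<open>a half turn is two quarter turns, to which the non-real case applies\<close>
    then have "f (c * z) = f (\<i> * (\<i> * z))" for z by simp
    then show ?thesis
      using nn_integral_rotate_nonreal[of "\<lambda>z. f (\<i> * z)" \<i>] nn_integral_rotate_nonreal[of f \<i>] by simp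
  qed simp
qed

lemma distr_lborel_rotate:
  fixes c :: complex
  assumes c: "cmod c = 1"
  shows "distr lborel borel ((*) c) = lborel"
proof (rule measure_eqI)
  fix A assume "A \<in> sets (distr lborel borel ((*) c))"
  then have [measurable]: "A \<in> sets borel" by simp
  have "emeasure (distr lborel borel ((*) c)) A = (\<integral>\<^sup>+z. indicator A (c * z) \<partial>lborel)"
    by (subst nn_integral_indicator[symmetric], simp, subst nn_integral_distr) auto
  also have "\<dots> = emeasure lborel A"
    by (subst nn_integral_rotate[OF _ c]) auto
  finally show "emeasure (distr lborel borel ((*) c)) A = emeasure lborel A" .
qed simp

lemma integral_lborel_translate:
  fixes c :: "'a::euclidean_space" and f :: "'a \<Rightarrow> 'b::{banach, second_countable_topology}"
  assumes "f \<in> borel_measurable borel"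
  shows "(\<integral>x. f (c + x) \<partial>lborel) = (\<integral>x. f x \<partial>lborel)"
  by (subst (2) lborel_distr_plus [of c, symmetric], subst integral_distr) (use assms in auto)

lemma integrable_lborel_translate:
  fixes c :: "'a::euclidean_space" and f :: "'a \<Rightarrow> 'b::{banach, second_countable_topology}"
  assumes "f \<in> borel_measurable borel"
  shows "integrable lborel (\<lambda>x. f (c + x)) \<longleftrightarrow> integrable lborel f"
  by (subst (2) lborel_distr_plus [of c, symmetric], subst integrable_distr_eq) (use assms in auto)

lemma nn_integral_gaussian_real:
  fixes b :: real
  assumes "b > 0"
  shows "(\<integral>\<^sup>+(x::real). ennreal (exp (- b * x\<^sup>2)) \<partial>lborel) = ennreal (sqrt (pi / b))"
proof -
  define \<sigma> where "\<sigma> = 1 / sqrt (2 * b)"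
  have s: "\<sigma> > 0" "2 * \<sigma>\<^sup>2 = 1 / b"
    using assms by (auto simp: \<sigma>_def power_divide)
  have "(\<integral>\<^sup>+(x::real). ennreal (exp (- b * x\<^sup>2)) \<partial>lborel)
      = (\<integral>\<^sup>+(x::real). ennreal (sqrt (pi / b)) * ennreal (normal_density 0 \<sigma> x) \<partial>lborel)"
  proof (rule nn_integral_cong)
    fix x :: real
    have "2 * pi * \<sigma>\<^sup>2 = pi / b" using s(2) by (simp add: field_simps)
    then have "exp (- b * x\<^sup>2) = sqrt (pi / b) * normal_density 0 \<sigma> x"
      unfolding normal_density_def using s assms by simp
    then show "ennreal (exp (- b * x\<^sup>2)) = ennreal (sqrt (pi / b)) * ennreal (normal_density 0 \<sigma> x)"
      using assms by (simp add: ennreal_mult')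
  qed
  also have "\<dots> = ennreal (sqrt (pi / b)) * (\<integral>\<^sup>+x. ennreal (normal_density 0 \<sigma> x) \<partial>lborel)"
    by (rule nn_integral_cmult) simp
  also have "(\<integral>\<^sup>+x. ennreal (normal_density 0 \<sigma> x) \<partial>lborel) = 1"
    using prob_space.emeasure_space_1[OF prob_space_normal_density[OF s(1), of 0]]
    by (simp add: emeasure_density)
  finally show ?thesis by simp
qed

text \<open>The Gaussian is the product of its two one-dimensional factors.\<close>

lemma nn_integral_gaussian_complex:
  fixes b :: real and c :: complex
  assumes "b > 0"
  shows "(\<integral>\<^sup>+z. ennreal (exp (- b * (cmod (z - c))\<^sup>2)) \<partial>lborel) = ennreal (pi / b)"
proof -
  have "(\<integral>\<^sup>+z. ennreal (exp (- b * (cmod (z - c))\<^sup>2)) \<partial>lborel) = (\<integral>\<^sup>+z. ennreal (exp (- b * (cmod z)\<^sup>2)) \<partial>lborel)"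
    by (subst nn_integral_lborel_translate[of _ c, symmetric]) auto
  also have "\<dots> = (\<integral>\<^sup>+x. \<integral>\<^sup>+y. ennreal (exp (- b * x\<^sup>2)) * ennreal (exp (- b * y\<^sup>2)) \<partial>lborel \<partial>lborel)"
    by (subst nn_integral_complex_y)
       (auto simp: cmod_power2 algebra_simps exp_add[symmetric] ennreal_mult[symmetric] exp_diff[symmetric]
         simp flip: exp_minus)
  also have "\<dots> = ennreal (sqrt (pi / b)) * ennreal (sqrt (pi / b))"
    using nn_integral_gaussian_real[OF assms] by (simp add: nn_integral_cmult nn_integral_multc)
  also have "\<dots> = ennreal (pi / b)"
    using assms by (simp add: ennreal_mult[symmetric])
  finally show ?thesis .
qed

lemma has_bochner_integral_gaussian:
  fixes b :: real and c :: complex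
  assumes "b > 0"
  shows "has_bochner_integral lborel (\<lambda>z. exp (- b * (cmod (z - c))\<^sup>2)) (pi / b)"
  using nn_integral_gaussian_complex[OF assms] assms
  by (intro has_bochner_integral_nn_integral) auto

section \<open>The Gaussian mean value property\<close>

lemma circle_mean_value:
  assumes "f holomorphic_on UNIV"
  shows "((\<lambda>t. f (cis (2 * pi * t) * w)) has_integral f 0) {0..1}"
proof -
  have "(\<lambda>u. f (u * w)) holomorphic_on UNIV"
    using holomorphic_on_compose_gen[of "\<lambda>u. u * w" UNIV f UNIV] assms
    by (simp add: o_def holomorphic_on_mult)
  then have h: "(\<lambda>u. f (u * w)) holomorphic_on cball 0 1"
    by (rule holomorphic_on_subset) simp
  have "((\<lambda>u. f (u * w) / (u - 0)) has_contour_integral (2 * of_real pi * \<i> * f (0 * w))) (circlepath 0 1)"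
    by (rule Cauchy_integral_circlepath_simple[OF h]) simp
  then have "((\<lambda>t. f (cis (2 * pi * t) * w) * (2 * pi * \<i>)) has_integral (f 0 * (2 * pi * \<i>))) {0..1}"
    unfolding has_contour_integral vector_derivative_circlepath
    by (simp add: circlepath cis_conv_exp mult_ac)
  then have "((\<lambda>t. f (cis (2 * pi * t) * w) * (2 * pi * \<i>) * inverse (2 * pi * \<i>))
      has_integral (f 0 * (2 * pi * \<i>) * inverse (2 * pi * \<i>))) {0..1}"
    by (rule has_integral_mult_left)
  moreover have "x * (2 * pi * \<i>) * inverse (2 * pi * \<i>) = x" for x :: complex
    by (subst mult.assoc, subst right_inverse) auto
  ultimately show ?thesis
    by (simp only:)
qed

text \<open>
  Compute the integral of \<open>f(e\<^bsup>2\<pi>it\<^esup> w) e\<^bsup>- \<alpha>|w|\<^sup>2\<^esup>\<close> over \<open>t \<in> [0, 1]\<close> and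
  \<open>w \<in> \<complex>\<close> in both orders. By rotation invariance the inner integral over \<open>w\<close> is independent of
  \<open>t\<close>; by the mean value property on circles the inner integral over \<open>t\<close> is
  \<open>f(0) e\<^bsup>- \<alpha>|w|\<^sup>2\<^esup>\<close>.
\<close>

lemma gaussian_mean_value:
  assumes f: "f holomorphic_on UNIV" and a: "\<alpha> > 0"
    and int: "integrable lborel (\<lambda>w. f w * of_real (exp (- \<alpha> * (cmod w)\<^sup>2)))"
  shows "(\<integral>w. f w * of_real (exp (- \<alpha> * (cmod w)\<^sup>2)) \<partial>lborel) = of_real (pi / \<alpha>) * f 0"
proof -
  have cont: "continuous_on UNIV f"
    using f holomorphic_on_imp_continuous_on by blast
  then have [measurable]: "f \<in> borel_measurable borel"
    by (rule borel_measurable_continuous_onI)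
  define g where "g = (\<lambda>w. f w * of_real (exp (- \<alpha> * (cmod w)\<^sup>2)))"
  have g [measurable]: "g \<in> borel_measurable borel"
    unfolding g_def by measurable
  define c where "c = (\<lambda>t. cis (2 * pi * t))"
  have c [simp]: "cmod (c t) = 1" for t by (simp add: c_def)
  have [measurable]: "c \<in> borel_measurable borel"
    unfolding c_def by (intro borel_measurable_continuous_onI continuous_intros)
  have rot: "(\<integral>w. h (c t * w) \<partial>lborel) = (\<integral>w. h w \<partial>lborel)"
    if [measurable]: "h \<in> borel_measurable borel" for h :: "complex \<Rightarrow> 'b::{banach, second_countable_topology}" and t
    by (subst (2) distr_lborel_rotate[OF c[of t], symmetric], subst integral_distr) auto
  have introt: "integrable lborel (\<lambda>w. g (c t * w))" for t
    using int unfolding g_def[symmetric]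
    by (subst (asm) distr_lborel_rotate[OF c[of t], symmetric], subst (asm) integrable_distr_eq) auto
  define F where "F = (\<lambda>t w. indicator {0..1} t *\<^sub>R g (c t * w))"
  have F: "integrable (lborel \<Otimes>\<^sub>M lborel) (\<lambda>(t, w). F t w)"
  proof (rule lborel_pair.Fubini_integrable)
    show "(\<lambda>(t, w). F t w) \<in> borel_measurable (lborel \<Otimes>\<^sub>M lborel)"
      unfolding F_def by measurable
    have "(\<integral>w. norm (F t w) \<partial>lborel) = indicator {0..1} t *\<^sub>R (\<integral>w. norm (g w) \<partial>lborel)" for t
      unfolding F_def using rot[of "\<lambda>w. norm (g w)" t] by (simp add: indicator_def)
    then show "integrable lborel (\<lambda>t. \<integral>w. norm (case (t, w) of (t, w) \<Rightarrow> F t w) \<partial>lborel)"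
      by simp
    show "AE t in lborel. integrable lborel (\<lambda>w. case (t, w) of (t, w) \<Rightarrow> F t w)"
      unfolding F_def using introt by (auto simp: indicator_def)
  qed
  have "(\<integral>t. F t w \<partial>lborel) = f 0 * of_real (exp (- \<alpha> * (cmod w)\<^sup>2))" for w
  proof -
    have "continuous_on {0..1} (\<lambda>t. f (c t * w))"
      unfolding c_def by (intro continuous_intros continuous_on_compose2[OF cont]) auto
    then have "set_integrable lborel {0..1} (\<lambda>t. f (c t * w))"
      by (intro borel_integrable_compact[unfolded set_integrable_def[symmetric]]) auto
    then have eq: "(LINT t:{0..1}|lborel. f (c t * w)) = f 0"
      using circle_mean_value[OF f, of w]
      by (simp add: set_borel_integral_eq_integral(2) integral_unique c_def)
    have "F t w = (indicator {0..1} t *\<^sub>R f (c t * w)) * of_real (exp (- \<alpha> * (cmod w)\<^sup>2))" for t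
      by (simp add: F_def g_def norm_mult)
    then have "(\<integral>t. F t w \<partial>lborel) = (\<integral>t. indicator {0..1} t *\<^sub>R f (c t * w) \<partial>lborel) * of_real (exp (- \<alpha> * (cmod w)\<^sup>2))"
      by (simp only: integral_mult_left_zero)
    then show ?thesis
      using eq by (simp add: set_lebesgue_integral_def)
  qed
  then have "(\<integral>w. \<integral>t. F t w \<partial>lborel \<partial>lborel) = f 0 * of_real (\<integral>w. exp (- \<alpha> * (cmod w)\<^sup>2) \<partial>lborel)"
    by simp
  also have "(\<integral>w. exp (- \<alpha> * (cmod w)\<^sup>2) \<partial>lborel) = pi / \<alpha>"
    using has_bochner_integral_gaussian[OF a, of 0] by (simp add: has_bochner_integral_iff)
  also have "(\<integral>w. \<integral>t. F t w \<partial>lborel \<partial>lborel) = (\<integral>t. \<integral>w. F t w \<partial>lborel \<partial>lborel)"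
    by (rule lborel_pair.Fubini_integral[OF F])
  also have "\<dots> = (\<integral>(t::real). indicator {0..1} t *\<^sub>R (\<integral>w. g w \<partial>lborel) \<partial>lborel)"
    by (simp only: F_def integral_scaleR_right rot[OF g])
  also have "\<dots> = (\<integral>w. g w \<partial>lborel)"
    by (subst integral_scaleR_left) auto
  finally show ?thesis
    by (simp add: g_def mult.commute)
qed

section \<open>Jensen's inequality for powers\<close>

text \<open>
  The graph of \<open>x\<^sup>r\<close> lies above its tangent at 1: this is Young's inequality for \<open>x = (x\<^sup>r)\<^bsup>1/r\<^esup> 1\<^bsup>1 - 1/r\<^esup>\<close>.
\<close>

lemma powr_tangent_at_1:
  fixes x r :: real
  assumes "x \<ge> 0" "r \<ge> 1"
  shows "1 + r * (x - 1) \<le> x powr r"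
proof (cases "x = 0")
  case False
  then have "(x powr r) powr (1 / r) * 1 powr (1 - 1 / r) \<le> 1 / r * x powr r + (1 - 1 / r) * 1"
    using assms by (intro Youngs_inequality_0) auto
  then have "x \<le> x powr r / r + 1 - 1 / r"
    using assms False by (simp add: powr_powr)
  then have "r * x \<le> r * (x powr r / r + 1 - 1 / r)"
    using assms by (intro mult_left_mono) auto
  also have "\<dots> = x powr r + r - 1"
    using assms by (simp add: algebra_simps)
  finally show ?thesis
    by (simp add: algebra_simps)
qed (use assms in auto)

text \<open>
  Jensen's inequality for weights of total mass at most 1. Since \<open>0\<^sup>r = 0\<close>, the missing mass may
  be thought of as placed at 0; the proof sums the tangent inequality at the mean \<open>m\<close>.
\<close>

lemma powr_sum_le_weighted:
  fixes u l :: "'i \<Rightarrow> real"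
  assumes "finite I" and l: "\<And>i. i \<in> I \<Longrightarrow> l i \<ge> 0" "(\<Sum>i\<in>I. l i) \<le> 1"
    and u: "\<And>i. i \<in> I \<Longrightarrow> u i \<ge> 0" and r: "r \<ge> 1"
  shows "(\<Sum>i\<in>I. l i * u i) powr r \<le> (\<Sum>i\<in>I. l i * u i powr r)"
proof -
  define m where "m = (\<Sum>i\<in>I. l i * u i)"
  have m: "m \<ge> 0" using l u by (auto simp: m_def intro!: sum_nonneg)
  show ?thesis
  proof (cases "m = 0")
    case True
    then show ?thesis using l by (auto simp: m_def intro!: sum_nonneg)
  next
    case False
    have "m powr r * (\<Sum>i\<in>I. l i * (1 + r * (u i / m - 1))) \<le> m powr r * (\<Sum>i\<in>I. l i * (u i / m) powr r)"
      using l u r m by (intro mult_left_mono sum_mono powr_tangent_at_1) auto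
    also have "\<dots> = (\<Sum>i\<in>I. l i * u i powr r)"
      using False m u by (auto simp: sum_distrib_left powr_divide intro!: sum.cong)
    also have "(\<Sum>i\<in>I. l i * (1 + r * (u i / m - 1))) = (\<Sum>i\<in>I. l i + (r / m * (l i * u i) - r * l i))"
      by (intro sum.cong) (auto simp: algebra_simps)
    also have "\<dots> = (\<Sum>i\<in>I. l i) + (r / m * m - r * (\<Sum>i\<in>I. l i))"
      by (simp only: sum.distrib sum_subtractf m_def sum_distrib_left)
    also have "\<dots> = 1 + (r - 1) * (1 - (\<Sum>i\<in>I. l i))"
      using False by (simp add: algebra_simps)
    finally have "m powr r * (1 + (r - 1) * (1 - (\<Sum>i\<in>I. l i))) \<le> (\<Sum>i\<in>I. l i * u i powr r)" .
    moreover have "m powr r * 1 \<le> m powr r * (1 + (r - 1) * (1 - (\<Sum>i\<in>I. l i)))"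
      using l r by (intro mult_left_mono) auto
    ultimately show ?thesis by (simp add: m_def)
  qed
qed

section \<open>Weighted entire functions and the reproducing formula\<close>

lemma gauss_weighted_add:
  "gauss_weighted \<alpha> (\<lambda>w. f w + g w) = (\<lambda>z. gauss_weighted \<alpha> f z + gauss_weighted \<alpha> g z)"
  by (simp add: gauss_weighted_def fun_eq_iff algebra_simps)

lemma gauss_weighted_scale: "gauss_weighted \<alpha> (\<lambda>w. a * f w) = (\<lambda>z. a * gauss_weighted \<alpha> f z)"
  by (simp add: gauss_weighted_def fun_eq_iff algebra_simps)

lemma gauss_weighted_diff:
  "gauss_weighted \<alpha> (\<lambda>w. f w - g w) = (\<lambda>z. gauss_weighted \<alpha> f z - gauss_weighted \<alpha> g z)"
  by (simp add: gauss_weighted_def fun_eq_iff algebra_simps)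

lemma gauss_weighted_sum:
  "gauss_weighted \<alpha> (\<lambda>w. \<Sum>i\<in>I. f i w) = (\<lambda>z. \<Sum>i\<in>I. gauss_weighted \<alpha> (f i) z)"
  by (simp add: gauss_weighted_def fun_eq_iff sum_distrib_right)

lemma gauss_weighted_zero [simp]: "gauss_weighted \<alpha> (\<lambda>_. 0) z = 0"
  by (simp add: gauss_weighted_def)

lemma continuous_gauss_weighted:
  assumes "f holomorphic_on UNIV"
  shows "continuous_on UNIV (gauss_weighted \<alpha> f)"
  using holomorphic_on_imp_continuous_on[OF assms]
  unfolding gauss_weighted_def[abs_def] by (intro continuous_intros)

lemma measurable_gauss_weighted:
  "f holomorphic_on UNIV \<Longrightarrow> gauss_weighted \<alpha> f \<in> borel_measurable borel"
  by (intro borel_measurable_continuous_onI continuous_gauss_weighted)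

lemma holomorphic_fock_kernel: "fock_kernel \<alpha> z holomorphic_on UNIV"
  unfolding fock_kernel_def[abs_def] by (intro holomorphic_intros)

text \<open>
  Completing the square. In the Gaussian weight the kernel at \<open>z\<close> is just the Gaussian bump at
  \<open>z\<close>; this is the only fact about the size of the kernels that the norm estimates use.
\<close>

lemma norm_gauss_weighted_fock_kernel:
  "cmod (gauss_weighted \<alpha> (fock_kernel \<alpha> z) w) = exp (- (\<alpha> / 2) * (cmod (w - z))\<^sup>2)"
proof -
  have "Re (of_real \<alpha> * cnj z * w - of_real (\<alpha> / 2 * (cmod z)\<^sup>2)) + (- (\<alpha> / 2) * (cmod w)\<^sup>2)
      = - (\<alpha> / 2) * (cmod (w - z))\<^sup>2"
    unfolding cmod_power2 by (simp add: power2_eq_square field_simps)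
  then show ?thesis
    unfolding gauss_weighted_def fock_kernel_def by (simp add: norm_mult exp_add[symmetric])
qed

text \<open>
  After the translation \<open>w = z + v\<close> the integrand of \<open>\<langle>f, k\<^sub>z\<rangle>\<close> is, up to the constant
  \<open>e\<^bsup>- \<alpha>|z|\<^sup>2/2\<^esup>\<close>, the entire function \<open>f(z + v) e\<^bsup>- \<alpha> cnj(z) v\<^esup>\<close> times
  \<open>e\<^bsup>- \<alpha>|v|\<^sup>2\<^esup>\<close>, and the Gaussian mean value property gives its value at \<open>v = 0\<close>. Taking
  absolute values in the same formula yields the pointwise estimate.
\<close>

lemma fock_reproducing:
  assumes f: "f holomorphic_on UNIV" and a: "\<alpha> > 0"
    and int: "integrable lborel (\<lambda>w. cmod (gauss_weighted \<alpha> f w) * exp (- (\<alpha> / 2) * (cmod (w - z))\<^sup>2))"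
  shows "fock_inner \<alpha> f (fock_kernel \<alpha> z) = gauss_weighted \<alpha> f z" (is ?A)
    and "cmod (gauss_weighted \<alpha> f z) \<le>
      \<alpha> / pi * (\<integral>w. cmod (gauss_weighted \<alpha> f w) * exp (- (\<alpha> / 2) * (cmod (w - z))\<^sup>2) \<partial>lborel)" (is ?B)
proof -
  define h where "h = (\<lambda>w. f w * cnj (fock_kernel \<alpha> z w) * of_real (exp (- \<alpha> * (cmod w)\<^sup>2)))"
  define g where "g = (\<lambda>v. f (z + v) * exp (- of_real \<alpha> * cnj z * v))"
  have cont: "continuous_on UNIV f" "continuous_on UNIV (fock_kernel \<alpha> z)"
    using f holomorphic_fock_kernel holomorphic_on_imp_continuous_on by blast+
  then have [measurable]: "h \<in> borel_measurable borel"
    unfolding h_def by (intro borel_measurable_continuous_onI continuous_intros)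
  have norm_h: "cmod (h w) = cmod (gauss_weighted \<alpha> f w) * exp (- (\<alpha> / 2) * (cmod (w - z))\<^sup>2)" for w
  proof -
    have "cmod (h w) = cmod (gauss_weighted \<alpha> f w) * cmod (gauss_weighted \<alpha> (fock_kernel \<alpha> z) w)"
      by (simp add: h_def gauss_weighted_def norm_mult exp_add[symmetric])
    then show ?thesis by (simp add: norm_gauss_weighted_fock_kernel)
  qed
  have inth: "integrable lborel h"
    using int by (subst integrable_norm_iff[symmetric]) (auto simp: norm_h)
  have shift: "h (z + v) = of_real (exp (- (\<alpha> / 2) * (cmod z)\<^sup>2)) * (g v * of_real (exp (- \<alpha> * (cmod v)\<^sup>2)))" for v
  proof -
    have "cnj (of_real \<alpha> * cnj z * (z + v) - of_real (\<alpha> / 2 * (cmod z)\<^sup>2)) + of_real (- \<alpha> * (cmod (z + v))\<^sup>2)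
        = of_real (- (\<alpha> / 2) * (cmod z)\<^sup>2) + (- of_real \<alpha> * cnj z * v + of_real (- \<alpha> * (cmod v)\<^sup>2))"
      unfolding cmod_power2 by (rule complex_eqI) (auto simp: power2_eq_square algebra_simps)
    then have eq: "exp (cnj (of_real \<alpha> * cnj z * (z + v) - of_real (\<alpha> / 2 * (cmod z)\<^sup>2))) * of_real (exp (- \<alpha> * (cmod (z + v))\<^sup>2))
        = of_real (exp (- (\<alpha> / 2) * (cmod z)\<^sup>2)) * (exp (- of_real \<alpha> * cnj z * v) * of_real (exp (- \<alpha> * (cmod v)\<^sup>2)))"
      by (simp only: exp_of_real[symmetric] exp_add[symmetric])
    show ?thesis
      using arg_cong[OF eq, of "\<lambda>x. f (z + v) * x"]
      by (simp only: h_def g_def fock_kernel_def exp_cnj mult_ac)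
  qed
  have holg: "g holomorphic_on UNIV"
    unfolding g_def using holomorphic_on_compose_gen[of "\<lambda>v. z + v" UNIV f UNIV] f
    by (intro holomorphic_intros) (simp add: o_def holomorphic_on_add)
  have "integrable lborel (\<lambda>v. h (z + v))"
    using inth by (simp add: integrable_lborel_translate)
  then have "integrable lborel (\<lambda>v. inverse (of_real (exp (- (\<alpha> / 2) * (cmod z)\<^sup>2))) * h (z + v))"
    by (rule integrable_mult_right)
  then have "integrable lborel (\<lambda>v. g v * of_real (exp (- \<alpha> * (cmod v)\<^sup>2)))"
    unfolding shift by (subst (asm) mult.assoc[symmetric], subst (asm) left_inverse) auto
  note mv = gaussian_mean_value[OF holg a this]
  have "(\<integral>w. h w \<partial>lborel) = (\<integral>v. h (z + v) \<partial>lborel)"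
    by (simp add: integral_lborel_translate)
  also have "\<dots> = of_real (exp (- (\<alpha> / 2) * (cmod z)\<^sup>2)) * (of_real (pi / \<alpha>) * f z)"
    unfolding shift by (subst integral_mult_right_zero, subst mv) (simp add: g_def)
  also have "\<dots> = of_real (pi / \<alpha>) * gauss_weighted \<alpha> f z"
    by (simp add: gauss_weighted_def)
  finally have *: "(\<integral>w. h w \<partial>lborel) = of_real (pi / \<alpha>) * gauss_weighted \<alpha> f z" .
  then show ?A
    using a unfolding fock_inner_def h_def by simp
  have "pi / \<alpha> * cmod (gauss_weighted \<alpha> f z) = cmod (\<integral>w. h w \<partial>lborel)"
    unfolding * using a by (simp add: norm_mult norm_divide)
  also have "\<dots> \<le> (\<integral>w. cmod (h w) \<partial>lborel)"
    by (rule integral_norm_bound)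
  finally show ?B
    using a by (simp add: norm_h field_simps)
qed

section \<open>Bounded functionals on spaces of functions\<close>

lemma dual_space_add:
  "\<phi> \<in> dual_space X \<Longrightarrow> f \<in> fs_carrier X \<Longrightarrow> g \<in> fs_carrier X \<Longrightarrow> \<phi> (\<lambda>w. f w + g w) = \<phi> f + \<phi> g"
  by (simp add: dual_space_def)

lemma dual_space_scale:
  "\<phi> \<in> dual_space X \<Longrightarrow> f \<in> fs_carrier X \<Longrightarrow> \<phi> (\<lambda>w. a * f w) = a * \<phi> f"
  by (simp add: dual_space_def)

text \<open>
  Homogeneity of the norm is what makes \<open>|\<phi>(f)| \<le> \<parallel>\<phi>\<parallel> \<parallel>f\<parallel>\<close> follow from the definition of the
  dual norm as a supremum over the unit ball. The norms of finite sums of kernels are estimated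
  in the concrete spaces.
\<close>

locale normed_fun_space =
  fixes X :: "'a fun_space"
  assumes zero_mem: "(\<lambda>_. 0) \<in> fs_carrier X"
    and add_mem: "f \<in> fs_carrier X \<Longrightarrow> g \<in> fs_carrier X \<Longrightarrow> (\<lambda>w. f w + g w) \<in> fs_carrier X"
    and scale_mem: "f \<in> fs_carrier X \<Longrightarrow> (\<lambda>w. a * f w) \<in> fs_carrier X"
    and norm_nonneg: "f \<in> fs_carrier X \<Longrightarrow> 0 \<le> fs_norm X f"
    and norm_scale: "f \<in> fs_carrier X \<Longrightarrow> fs_norm X (\<lambda>w. a * f w) = cmod a * fs_norm X f"
begin

lemma diff_mem: "f \<in> fs_carrier X \<Longrightarrow> g \<in> fs_carrier X \<Longrightarrow> (\<lambda>w. f w - g w) \<in> fs_carrier X"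
  using add_mem[of f "\<lambda>w. (-1) * g w"] scale_mem[of g "-1"] by simp

lemma sum_mem:
  "finite I \<Longrightarrow> (\<And>i. i \<in> I \<Longrightarrow> f i \<in> fs_carrier X) \<Longrightarrow> (\<lambda>w. \<Sum>i\<in>I. c i * f i w) \<in> fs_carrier X"
  by (induction rule: finite_induct) (auto simp: zero_mem add_mem[OF scale_mem])

lemma dual_space_sum:
  assumes \<phi>: "\<phi> \<in> dual_space X"
  shows "finite I \<Longrightarrow> (\<And>i. i \<in> I \<Longrightarrow> f i \<in> fs_carrier X) \<Longrightarrow>
    \<phi> (\<lambda>w. \<Sum>i\<in>I. c i * f i w) = (\<Sum>i\<in>I. c i * \<phi> (f i))"
proof (induction rule: finite_induct)
  case empty
  show ?case using dual_space_scale[OF \<phi> zero_mem, of 0] by simp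
next
  case (insert i I)
  have "\<phi> (\<lambda>w. c i * f i w + (\<Sum>i\<in>I. c i * f i w)) = \<phi> (\<lambda>w. c i * f i w) + \<phi> (\<lambda>w. \<Sum>i\<in>I. c i * f i w)"
    using insert by (intro dual_space_add[OF \<phi>] scale_mem sum_mem) auto
  moreover have "\<phi> (\<lambda>w. c i * f i w) = c i * \<phi> (f i)"
    using insert by (intro dual_space_scale[OF \<phi>]) auto
  ultimately show ?case using insert by simp
qed

lemma dual_space_diff:
  assumes "\<phi> \<in> dual_space X" "f \<in> fs_carrier X" "g \<in> fs_carrier X"
  shows "\<phi> (\<lambda>w. f w - g w) = \<phi> f - \<phi> g"
proof -
  show ?thesis
    using dual_space_add[OF assms(1,2) scale_mem[OF assms(3), of "-1"]] dual_space_scale[OF assms(1,3), of "-1"]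
    by simp
qed

lemma dual_norm_bdd:
  assumes "\<phi> \<in> dual_space X"
  shows "bdd_above ((\<lambda>f. cmod (\<phi> f)) ` {f \<in> fs_carrier X. fs_norm X f \<le> 1})"
proof -
  from assms obtain C where C: "\<And>f. f \<in> fs_carrier X \<Longrightarrow> cmod (\<phi> f) \<le> C * fs_norm X f"
    unfolding dual_space_def by blast
  have "cmod (\<phi> f) \<le> \<bar>C\<bar>" if "f \<in> fs_carrier X" "fs_norm X f \<le> 1" for f
  proof -
    have "cmod (\<phi> f) \<le> \<bar>C\<bar> * fs_norm X f"
      using C[OF that(1)] norm_nonneg[OF that(1)]
      by (meson abs_ge_self mult_right_mono order_trans)
    also have "\<dots> \<le> \<bar>C\<bar> * 1"
      using that by (intro mult_left_mono) auto
    finally show ?thesis by simp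
  qed
  then show ?thesis by (intro bdd_aboveI[of _ "\<bar>C\<bar>"]) auto
qed

lemma norm_zero: "fs_norm X (\<lambda>_. 0) = 0"
  using norm_scale[OF zero_mem, of 0] by simp

lemma dual_norm_nonneg:
  assumes "\<phi> \<in> dual_space X"
  shows "0 \<le> dual_norm X \<phi>"
  unfolding dual_norm_def
  using norm_zero zero_mem by (intro cSUP_upper2[OF dual_norm_bdd[OF assms], of "\<lambda>_. 0"]) auto

text \<open>
  The usual normalisation argument; on functions of norm 0, where one cannot normalise, a bounded
  functional vanishes.
\<close>

lemma dual_norm_bound:
  assumes \<phi>: "\<phi> \<in> dual_space X" and f: "f \<in> fs_carrier X"
  shows "cmod (\<phi> f) \<le> dual_norm X \<phi> * fs_norm X f"
proof (cases "fs_norm X f = 0")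
  case True
  then show ?thesis using \<phi> f unfolding dual_space_def by auto
next
  case False
  define t where "t = fs_norm X f"
  have t: "t > 0" using False norm_nonneg[OF f] by (simp add: t_def)
  let ?g = "\<lambda>w. of_real (1 / t) * f w"
  have "?g \<in> fs_carrier X" "fs_norm X ?g \<le> 1"
    using t scale_mem[OF f, of "of_real (1 / t)"] norm_scale[OF f, of "of_real (1 / t)"]
    by (auto simp: t_def norm_divide)
  then have "cmod (\<phi> ?g) \<le> dual_norm X \<phi>"
    unfolding dual_norm_def by (intro cSUP_upper[OF _ dual_norm_bdd[OF \<phi>]]) auto
  moreover have "\<phi> ?g = of_real (1 / t) * \<phi> f"
    by (rule dual_space_scale[OF \<phi> f])
  ultimately have "1 / t * cmod (\<phi> f) \<le> dual_norm X \<phi>"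
    using t by (simp add: norm_mult norm_divide)
  then show ?thesis
    using t by (simp add: field_simps t_def)
qed

end

section \<open>Fock spaces\<close>

text \<open>
  What \<open>F\<^sup>p\<close>, \<open>F\<^sup>\<infinity>\<close> and \<open>f\<^sup>\<infinity>\<close> have in common: an entire function that is dominated by
  a fixed Gaussian, after weighting, belongs to the space, with norm controlled by the factor \<open>D\<close>.
  The value 2 is a constant that works for all exponents at once. This one property gives both
  the membership of the kernels and their continuous dependence on the point.
\<close>

locale gauss_weighted_space = normed_fun_space X for X :: "complex fun_space" +
  fixes \<alpha> :: real
  assumes alpha_pos: "\<alpha> > 0"
    and gaussian_decay_mem: "f holomorphic_on UNIV \<Longrightarrow> 0 \<le> D \<Longrightarrow>
      (\<And>w. cmod (gauss_weighted \<alpha> f w) \<le> D * exp (- (\<alpha> / 4) * (cmod w)\<^sup>2)) \<Longrightarrow> f \<in> fs_carrier X"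
    and gaussian_decay_norm: "f holomorphic_on UNIV \<Longrightarrow> 0 \<le> D \<Longrightarrow>
      (\<And>w. cmod (gauss_weighted \<alpha> f w) \<le> D * exp (- (\<alpha> / 4) * (cmod w)\<^sup>2)) \<Longrightarrow> fs_norm X f \<le> 2 * D"
begin

lemma fock_kernel_mem: "fock_kernel \<alpha> z \<in> fs_carrier X"
proof (rule gaussian_decay_mem[OF holomorphic_fock_kernel])
  fix w
  have "(cmod w)\<^sup>2 \<le> (cmod (w - z) + cmod z)\<^sup>2"
    by (rule power_mono) (use norm_triangle_sub[of w z] in auto)
  also have "\<dots> \<le> 2 * (cmod (w - z))\<^sup>2 + 2 * (cmod z)\<^sup>2"
    using zero_le_power2[of "cmod (w - z) - cmod z"] by (simp add: power2_eq_square algebra_simps)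
  finally have "\<alpha> / 4 * (cmod w)\<^sup>2 \<le> \<alpha> / 4 * (2 * (cmod (w - z))\<^sup>2 + 2 * (cmod z)\<^sup>2)"
    using alpha_pos by (intro mult_left_mono) auto
  then show "cmod (gauss_weighted \<alpha> (fock_kernel \<alpha> z) w)
      \<le> exp (\<alpha> / 2 * (cmod z)\<^sup>2) * exp (- (\<alpha> / 4) * (cmod w)\<^sup>2)"
    unfolding norm_gauss_weighted_fock_kernel by (simp add: exp_add[symmetric] algebra_simps)
qed simp

text \<open>
  The exponentials \<open>e\<^bsup>\<alpha> cnj(z) w\<^esup>\<close> depend on \<open>z\<close> in a Lipschitz way near each \<open>z\<^sub>0\<close>, uniformly
  in \<open>w\<close> up to a factor \<open>|w| e\<^bsup>\<alpha>R|w|\<^esup>\<close> that half of the Gaussian weight absorbs.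
\<close>

lemma continuous_dual_fock_kernel:
  assumes \<phi>: "\<phi> \<in> dual_space X"
  shows "continuous_on UNIV (\<lambda>z. \<phi> (fock_kernel \<alpha> z))"
proof -
  define e where "e = (\<lambda>z w. exp (of_real \<alpha> * cnj z * w) :: complex)"
  have kernel_e: "fock_kernel \<alpha> z = (\<lambda>w. exp (- of_real (\<alpha> / 2 * (cmod z)\<^sup>2)) * e z w)" for z
    unfolding fock_kernel_def e_def exp_add[symmetric] by simp
  have "e z = (\<lambda>w. exp (of_real (\<alpha> / 2 * (cmod z)\<^sup>2)) * fock_kernel \<alpha> z w)" for z
    unfolding kernel_e by (simp add: mult.assoc[symmetric] exp_add[symmetric])
  then have e_mem: "e z \<in> fs_carrier X" for z
    using scale_mem[OF fock_kernel_mem] by simp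
  have "continuous_on UNIV (\<lambda>z. \<phi> (e z))"
  proof (rule continuous_at_imp_continuous_on, rule ballI)
    fix z0 :: complex
    define R where "R = cmod z0 + 1"
    define C where "C = \<alpha> * exp ((\<alpha> * R + 1)\<^sup>2 / \<alpha>)"
    have C: "C \<ge> 0" using alpha_pos by (simp add: C_def)
    have lip: "cmod (\<phi> (e z) - \<phi> (e z0)) \<le> dual_norm X \<phi> * (2 * (cmod (z - z0) * C))" if z: "dist z z0 < 1" for z
    proof -
      have zR: "cmod z \<le> R" "cmod z0 \<le> R"
        using z norm_triangle_sub[of z z0] by (auto simp: R_def dist_norm)
      have "cmod (gauss_weighted \<alpha> (\<lambda>w. e z w - e z0 w) w) \<le> (cmod (z - z0) * C) * exp (- (\<alpha> / 4) * (cmod w)\<^sup>2)" for w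
      proof -
        define t where "t = cmod w"
        have t: "t \<ge> 0" by (simp add: t_def)
        have "cmod (of_real \<alpha> * cnj u * w) \<le> \<alpha> * R * t" if "cmod u \<le> R" for u
          using that alpha_pos by (simp add: norm_mult t_def mult_right_mono)
        then have "cmod (exp (of_real \<alpha> * cnj z * w) - exp (of_real \<alpha> * cnj z0 * w))
            \<le> exp (\<alpha> * R * t) * cmod (of_real \<alpha> * cnj z * w - of_real \<alpha> * cnj z0 * w)"
          using zR
          by (intro field_differentiable_bound[of "cball 0 (\<alpha> * R * t)" exp exp])
             (auto intro: DERIV_exp DERIV_subset intro!: derivative_eq_intros exp_le_cancel_iff[THEN iffD2] order_trans[OF complex_Re_le_cmod])
        also have "of_real \<alpha> * cnj z * w - of_real \<alpha> * cnj z0 * w = of_real \<alpha> * cnj (z - z0) * w"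
          by (simp add: algebra_simps)
        also have "cmod (of_real \<alpha> * cnj (z - z0) * w) = \<alpha> * cmod (z - z0) * t"
          using alpha_pos by (simp add: norm_mult t_def del: complex_cnj_diff)
        finally have "cmod (gauss_weighted \<alpha> (\<lambda>w. e z w - e z0 w) w)
            \<le> exp (\<alpha> * R * t) * (\<alpha> * cmod (z - z0) * t) * exp (- (\<alpha> / 2) * t\<^sup>2)"
          unfolding gauss_weighted_def e_def norm_mult t_def[symmetric] using alpha_pos t by (intro mult_mono) auto
        also have "\<dots> \<le> exp (\<alpha> * R * t) * (\<alpha> * cmod (z - z0) * exp t) * exp (- (\<alpha> / 2) * t\<^sup>2)"
        proof -
          have "t \<le> exp t" using exp_ge_add_one_self[of t] by linarith
          then show ?thesis
            using alpha_pos by (intro mult_right_mono mult_left_mono) auto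
        qed
        also have "\<dots> = \<alpha> * cmod (z - z0) * exp ((\<alpha> * R + 1) * t - \<alpha> / 2 * t\<^sup>2)"
        proof -
          have "exp (\<alpha> * R * t) * exp t * exp (- (\<alpha> / 2) * t\<^sup>2) = exp ((\<alpha> * R + 1) * t - \<alpha> / 2 * t\<^sup>2)"
            unfolding exp_add[symmetric] by (simp add: algebra_simps)
          from arg_cong[OF this, of "\<lambda>x. \<alpha> * cmod (z - z0) * x"] show ?thesis
            by (simp only: mult_ac)
        qed
        also have "\<dots> \<le> \<alpha> * cmod (z - z0) * exp ((\<alpha> * R + 1)\<^sup>2 / \<alpha> - \<alpha> / 4 * t\<^sup>2)"
        proof (intro mult_left_mono exp_le_cancel_iff[THEN iffD2])
          \<comment> \<open>completing the square in \<open>t\<close>\<close>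
          have "0 \<le> (\<alpha> * R + 1 - \<alpha> * t / 2)\<^sup>2 / \<alpha>"
            using alpha_pos by simp
          also have "\<dots> = (\<alpha> * R + 1)\<^sup>2 / \<alpha> - (\<alpha> * R + 1) * t + \<alpha> / 4 * t\<^sup>2"
            using alpha_pos by (simp add: power2_eq_square field_simps)
          finally show "(\<alpha> * R + 1) * t - \<alpha> / 2 * t\<^sup>2 \<le> (\<alpha> * R + 1)\<^sup>2 / \<alpha> - \<alpha> / 4 * t\<^sup>2"
            by (simp add: algebra_simps)
        qed (use alpha_pos in auto)
        also have "\<dots> = (cmod (z - z0) * C) * exp (- (\<alpha> / 4) * t\<^sup>2)"
        proof -
          have "exp ((\<alpha> * R + 1)\<^sup>2 / \<alpha> - \<alpha> / 4 * t\<^sup>2) = exp ((\<alpha> * R + 1)\<^sup>2 / \<alpha>) * exp (- (\<alpha> / 4) * t\<^sup>2)"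
            unfolding exp_add[symmetric] by simp
          then show ?thesis unfolding C_def by (simp only: mult_ac)
        qed
        finally show ?thesis by (simp add: t_def)
      qed
      then have "fs_norm X (\<lambda>w. e z w - e z0 w) \<le> 2 * (cmod (z - z0) * C)"
        using C by (intro gaussian_decay_norm) (auto simp: e_def intro!: holomorphic_intros)
      then have "dual_norm X \<phi> * fs_norm X (\<lambda>w. e z w - e z0 w) \<le> dual_norm X \<phi> * (2 * (cmod (z - z0) * C))"
        using dual_norm_nonneg[OF \<phi>] by (intro mult_left_mono) auto
      then show ?thesis
        using dual_norm_bound[OF \<phi> diff_mem[OF e_mem e_mem], of z z0] dual_space_diff[OF \<phi> e_mem e_mem, of z z0]
        by simp
    qed
    have "((\<lambda>z. dual_norm X \<phi> * (2 * (cmod (z - z0) * C))) \<longlongrightarrow> dual_norm X \<phi> * (2 * (cmod (z0 - z0) * C))) (at z0)"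
      by (intro tendsto_intros)
    then have lim: "((\<lambda>z. dual_norm X \<phi> * (2 * (cmod (z - z0) * C))) \<longlongrightarrow> 0) (at z0)"
      by simp
    have "((\<lambda>z. \<phi> (e z) - \<phi> (e z0)) \<longlongrightarrow> 0) (at z0)"
    proof (rule Lim_null_comparison[OF _ lim])
      show "\<forall>\<^sub>F z in at z0. cmod (\<phi> (e z) - \<phi> (e z0)) \<le> dual_norm X \<phi> * (2 * (cmod (z - z0) * C))"
        using lip by (auto simp: eventually_at intro!: exI[of _ 1])
    qed
    then show "isCont (\<lambda>z. \<phi> (e z)) z0"
      by (simp add: isCont_def LIM_zero_cancel)
  qed
  moreover have "\<phi> (fock_kernel \<alpha> z) = exp (- of_real (\<alpha> / 2 * (cmod z)\<^sup>2)) * \<phi> (e z)" for z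
    unfolding kernel_e by (rule dual_space_scale[OF \<phi> e_mem])
  ultimately show ?thesis
    by (simp add: continuous_intros)
qed

end

lemma fock_top:
  "fs_carrier (fock \<alpha> top) = {f. f holomorphic_on UNIV \<and> bdd_above (range (\<lambda>z. cmod (gauss_weighted \<alpha> f z)))}"
  "fs_norm (fock \<alpha> top) f = (SUP z. cmod (gauss_weighted \<alpha> f z))"
  by (simp_all add: fock_def)

lemma fock_finite:
  assumes "p \<ge> 1"
  shows "fs_carrier (fock \<alpha> (ennreal p)) = {f. f holomorphic_on UNIV \<and>
             integrable lborel (\<lambda>z. cmod (gauss_weighted \<alpha> f z) powr p)}"
    "fs_norm (fock \<alpha> (ennreal p)) f =
      (p * \<alpha> / (2 * pi) * (\<integral>z. cmod (gauss_weighted \<alpha> f z) powr p \<partial>lborel)) powr (1 / p)"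
  using assms by (simp_all add: fock_def)

lemma normed_fun_space_fock_top: "normed_fun_space (fock \<alpha> top)"
proof
  fix f g assume f: "f \<in> fs_carrier (fock \<alpha> top)"
  then obtain B where B: "\<And>z. cmod (gauss_weighted \<alpha> f z) \<le> B"
    by (auto simp: fock_top bdd_above_def)
  have bdd: "bdd_above (range (\<lambda>z. cmod (gauss_weighted \<alpha> f z)))"
    using f by (simp add: fock_top)
  show "0 \<le> fs_norm (fock \<alpha> top) f"
    unfolding fock_top by (rule cSUP_upper2[OF bdd, of 0]) auto
  {
    assume "g \<in> fs_carrier (fock \<alpha> top)"
    then obtain C where C: "\<And>z. cmod (gauss_weighted \<alpha> g z) \<le> C"
      by (auto simp: fock_top bdd_above_def)
    have "cmod (gauss_weighted \<alpha> (\<lambda>w. f w + g w) z) \<le> B + C" for z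
      unfolding gauss_weighted_add using norm_triangle_mono[OF B C] .
    then show "(\<lambda>w. f w + g w) \<in> fs_carrier (fock \<alpha> top)"
      using f \<open>g \<in> _\<close> by (auto simp: fock_top intro!: bdd_aboveI2 intro: holomorphic_on_add)
  }
  fix a
  have "cmod (gauss_weighted \<alpha> (\<lambda>w. a * f w) z) \<le> cmod a * B" for z
    unfolding gauss_weighted_scale norm_mult using B by (intro mult_left_mono) auto
  then show "(\<lambda>w. a * f w) \<in> fs_carrier (fock \<alpha> top)"
    using f by (auto simp: fock_top intro!: bdd_aboveI2 intro: holomorphic_on_mult)
  show "fs_norm (fock \<alpha> top) (\<lambda>w. a * f w) = cmod a * fs_norm (fock \<alpha> top) f"
    unfolding fock_top gauss_weighted_scale norm_mult
    using continuous_at_Sup_mono[of "\<lambda>x. cmod a * x" "range (\<lambda>z. cmod (gauss_weighted \<alpha> f z))"] bdd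
    by (simp add: image_image monoI mult_left_mono continuous_mult_left)
qed (auto simp: fock_top)

lemma gauss_weighted_space_fock_top:
  assumes "\<alpha> > 0"
  shows "gauss_weighted_space (fock \<alpha> top) \<alpha>"
proof -
  interpret normed_fun_space "fock \<alpha> top" by (rule normed_fun_space_fock_top)
  show ?thesis
  proof
    fix f D assume f: "f holomorphic_on UNIV" "0 \<le> D"
      "\<And>w. cmod (gauss_weighted \<alpha> f w) \<le> D * exp (- (\<alpha> / 4) * (cmod w)\<^sup>2)"
    have le: "cmod (gauss_weighted \<alpha> f w) \<le> D" for w
      using assms f(2) by (intro order_trans[OF f(3)] mult_left_le) auto
    then show "f \<in> fs_carrier (fock \<alpha> top)"
      using f(1) by (auto simp: fock_top intro!: bdd_aboveI2)
    have "fs_norm (fock \<alpha> top) f \<le> D"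
      unfolding fock_top using le by (intro cSUP_least) auto
    then show "fs_norm (fock \<alpha> top) f \<le> 2 * D" using f(2) by simp
  qed (rule assms)
qed

lemma gauss_weighted_space_little_fock:
  assumes "\<alpha> > 0"
  shows "gauss_weighted_space (little_fock \<alpha>) \<alpha>"
proof -
  interpret F: gauss_weighted_space "fock \<alpha> top" \<alpha> by (rule gauss_weighted_space_fock_top[OF assms])
  have mem: "f \<in> fs_carrier (little_fock \<alpha>) \<longleftrightarrow>
      f \<in> fs_carrier (fock \<alpha> top) \<and> (gauss_weighted \<alpha> f \<longlongrightarrow> 0) at_infinity" for f
    by (simp add: little_fock_def)
  have norm: "fs_norm (little_fock \<alpha>) = fs_norm (fock \<alpha> top)"
    by (simp add: little_fock_def)
  show ?thesis
  proof
    show "(\<lambda>_. 0) \<in> fs_carrier (little_fock \<alpha>)"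
      using F.zero_mem by (simp add: mem gauss_weighted_def[abs_def])
  next
    fix f g assume "f \<in> fs_carrier (little_fock \<alpha>)" "g \<in> fs_carrier (little_fock \<alpha>)"
    then show "(\<lambda>w. f w + g w) \<in> fs_carrier (little_fock \<alpha>)"
      using F.add_mem by (auto simp: mem gauss_weighted_add intro: tendsto_add_zero)
  next
    fix f a assume "f \<in> fs_carrier (little_fock \<alpha>)"
    then show "(\<lambda>w. a * f w) \<in> fs_carrier (little_fock \<alpha>)"
      using F.scale_mem by (auto simp: mem gauss_weighted_scale intro: tendsto_mult_right_zero)
  next
    fix f D assume f: "f holomorphic_on UNIV" "0 \<le> D"
      "\<And>w. cmod (gauss_weighted \<alpha> f w) \<le> D * exp (- (\<alpha> / 4) * (cmod w)\<^sup>2)"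
    have "((\<lambda>x::real. D * exp (- (\<alpha> / 4) * x\<^sup>2)) \<longlongrightarrow> 0) at_top"
      using assms by real_asymp
    then have "((\<lambda>w::complex. D * exp (- (\<alpha> / 4) * (cmod w)\<^sup>2)) \<longlongrightarrow> 0) at_infinity"
      by (rule filterlim_compose) (rule filterlim_norm_at_top)
    then have "(gauss_weighted \<alpha> f \<longlongrightarrow> 0) at_infinity"
      by (rule Lim_null_comparison[rotated]) (use f(3) in auto)
    then show "f \<in> fs_carrier (little_fock \<alpha>)"
      using F.gaussian_decay_mem[OF f] by (simp add: mem)
  qed (auto simp: mem norm F.norm_nonneg F.norm_scale F.gaussian_decay_norm assms)
qed

lemma normed_fun_space_fock_finite:
  assumes p: "p \<ge> 1" and a: "\<alpha> > 0"
  shows "normed_fun_space (fock \<alpha> (ennreal p))"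
proof
  show "(\<lambda>_. 0) \<in> fs_carrier (fock \<alpha> (ennreal p))"
    by (simp add: fock_finite[OF p])
next
  fix f g assume f: "f \<in> fs_carrier (fock \<alpha> (ennreal p))" and g: "g \<in> fs_carrier (fock \<alpha> (ennreal p))"
  have m: "(\<lambda>w. f w + g w) holomorphic_on UNIV"
    using f g by (auto simp: fock_finite[OF p] intro: holomorphic_on_add)
  have "integrable lborel (\<lambda>z. 2 powr p * (cmod (gauss_weighted \<alpha> f z) powr p + cmod (gauss_weighted \<alpha> g z) powr p))"
    using f g by (auto simp: fock_finite[OF p])
  then have "integrable lborel (\<lambda>z. cmod (gauss_weighted \<alpha> (\<lambda>w. f w + g w) z) powr p)"
  proof (rule Bochner_Integration.integrable_bound)
    show "(\<lambda>z. cmod (gauss_weighted \<alpha> (\<lambda>w. f w + g w) z) powr p) \<in> borel_measurable lborel"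
      using measurable_gauss_weighted[OF m] by simp
    show "AE z in lborel. norm (cmod (gauss_weighted \<alpha> (\<lambda>w. f w + g w) z) powr p)
        \<le> norm (2 powr p * (cmod (gauss_weighted \<alpha> f z) powr p + cmod (gauss_weighted \<alpha> g z) powr p))"
    proof (rule AE_I2)
      fix z
      let ?x = "cmod (gauss_weighted \<alpha> f z)" and ?y = "cmod (gauss_weighted \<alpha> g z)"
      have "cmod (gauss_weighted \<alpha> (\<lambda>w. f w + g w) z) powr p \<le> (2 * max ?x ?y) powr p"
        unfolding gauss_weighted_add using p
        by (intro powr_mono2 order_trans[OF norm_triangle_ineq]) auto
      also have "\<dots> = 2 powr p * max (?x powr p) (?y powr p)"
        using p powr_mono2[of p ?x ?y] powr_mono2[of p ?y ?x] by (auto simp: powr_mult max_def)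
      also have "\<dots> \<le> 2 powr p * (?x powr p + ?y powr p)"
        by (intro mult_left_mono) auto
      finally show "norm (cmod (gauss_weighted \<alpha> (\<lambda>w. f w + g w) z) powr p) \<le> norm (2 powr p * (?x powr p + ?y powr p))"
        by simp
    qed
  qed
  then show "(\<lambda>w. f w + g w) \<in> fs_carrier (fock \<alpha> (ennreal p))"
    using m by (auto simp: fock_finite[OF p])
next
  fix f c assume f: "f \<in> fs_carrier (fock \<alpha> (ennreal p))"
  show "(\<lambda>w. c * f w) \<in> fs_carrier (fock \<alpha> (ennreal p))"
    using f by (auto simp: fock_finite[OF p] gauss_weighted_scale norm_mult powr_mult intro: holomorphic_on_mult)
  have "fs_norm (fock \<alpha> (ennreal p)) (\<lambda>w. c * f w)
      = (cmod c powr p * (p * \<alpha> / (2 * pi) * (\<integral>z. cmod (gauss_weighted \<alpha> f z) powr p \<partial>lborel))) powr (1 / p)"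
    by (simp add: fock_finite[OF p] gauss_weighted_scale norm_mult powr_mult mult_ac)
  also have "\<dots> = cmod c * fs_norm (fock \<alpha> (ennreal p)) f"
    using p a unfolding fock_finite[OF p] by (subst powr_mult) (auto simp: powr_powr)
  finally show "fs_norm (fock \<alpha> (ennreal p)) (\<lambda>w. c * f w) = cmod c * fs_norm (fock \<alpha> (ennreal p)) f" .
qed (simp add: fock_finite[OF p])

lemma fock_norm_le_nn_integral:
  assumes p: "p \<ge> 1" and a: "\<alpha> > 0" and f: "f holomorphic_on UNIV" and B: "B \<ge> 0"
    and le: "(\<integral>\<^sup>+z. ennreal (cmod (gauss_weighted \<alpha> f z) powr p) \<partial>lborel) \<le> ennreal B"
  shows "f \<in> fs_carrier (fock \<alpha> (ennreal p))"
    and "fs_norm (fock \<alpha> (ennreal p)) f \<le> (p * \<alpha> / (2 * pi) * B) powr (1 / p)"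
proof -
  have m: "(\<lambda>z. cmod (gauss_weighted \<alpha> f z) powr p) \<in> borel_measurable lborel"
    using measurable_gauss_weighted[OF f] by simp
  have fin: "(\<integral>\<^sup>+z. ennreal (norm (cmod (gauss_weighted \<alpha> f z) powr p)) \<partial>lborel) < top"
    using le by (simp add: le_less_trans)
  have int: "integrable lborel (\<lambda>z. cmod (gauss_weighted \<alpha> f z) powr p)"
    using m fin by (simp add: integrable_iff_bounded)
  then show "f \<in> fs_carrier (fock \<alpha> (ennreal p))"
    using f by (simp add: fock_finite[OF p])
  have "(\<integral>z. cmod (gauss_weighted \<alpha> f z) powr p \<partial>lborel) \<le> B"
    using le B by (subst (asm) nn_integral_eq_integral[OF int]) (auto simp: ennreal_le_iff)
  then show "fs_norm (fock \<alpha> (ennreal p)) f \<le> (p * \<alpha> / (2 * pi) * B) powr (1 / p)"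
    unfolding fock_finite[OF p] using p a
    by (intro powr_mono2 mult_left_mono) auto
qed

lemma gauss_weighted_space_fock_finite:
  assumes p: "p \<ge> 1" and a: "\<alpha> > 0"
  shows "gauss_weighted_space (fock \<alpha> (ennreal p)) \<alpha>"
proof -
  interpret normed_fun_space "fock \<alpha> (ennreal p)" by (rule normed_fun_space_fock_finite[OF p a])
  show ?thesis
  proof
    fix f D assume f: "f holomorphic_on UNIV" "0 \<le> D"
      "\<And>w. cmod (gauss_weighted \<alpha> f w) \<le> D * exp (- (\<alpha> / 4) * (cmod w)\<^sup>2)"
    have "(\<integral>\<^sup>+z. ennreal (cmod (gauss_weighted \<alpha> f z) powr p) \<partial>lborel)
        \<le> (\<integral>\<^sup>+z. ennreal (D powr p) * ennreal (exp (- (p * \<alpha> / 4) * (cmod (z - 0))\<^sup>2)) \<partial>lborel)"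
    proof (rule nn_integral_mono)
      fix z :: complex
      have "cmod (gauss_weighted \<alpha> f z) powr p \<le> (D * exp (- (\<alpha> / 4) * (cmod z)\<^sup>2)) powr p"
        using f p by (intro powr_mono2) auto
      also have "\<dots> = D powr p * exp (- (p * \<alpha> / 4) * (cmod (z - 0))\<^sup>2)"
        using f by (simp add: powr_mult exp_powr_real mult_ac)
      finally show "ennreal (cmod (gauss_weighted \<alpha> f z) powr p)
          \<le> ennreal (D powr p) * ennreal (exp (- (p * \<alpha> / 4) * (cmod (z - 0))\<^sup>2))"
        by (simp add: ennreal_mult[symmetric])
    qed
    also have "\<dots> = ennreal (D powr p) * ennreal (pi / (p * \<alpha> / 4))"
      using p a by (subst nn_integral_cmult, measurable, subst nn_integral_gaussian_complex) auto
    also have "\<dots> = ennreal (D powr p * (pi / (p * \<alpha> / 4)))"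
      using p a by (subst ennreal_mult) auto
    finally have le: "(\<integral>\<^sup>+z. ennreal (cmod (gauss_weighted \<alpha> f z) powr p) \<partial>lborel) \<le> \<dots>" .
    have B: "D powr p * (pi / (p * \<alpha> / 4)) \<ge> 0" using p a by simp
    note * = fock_norm_le_nn_integral[OF p a f(1) B le]
    show "f \<in> fs_carrier (fock \<alpha> (ennreal p))" by (rule *)
    have "p * \<alpha> / (2 * pi) * (D powr p * (pi / (p * \<alpha> / 4))) = 2 * D powr p"
      using p a by (simp add: field_simps)
    also have "\<dots> \<le> (2 * D) powr p"
      using p f powr_mono[of 1 p 2] by (simp add: powr_mult mult_right_mono)
    finally have "(p * \<alpha> / (2 * pi) * (D powr p * (pi / (p * \<alpha> / 4)))) powr (1 / p) \<le> ((2 * D) powr p) powr (1 / p)"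
      using p a by (intro powr_mono2) auto
    also have "\<dots> = 2 * D" using p f by (simp add: powr_powr)
    finally show "fs_norm (fock \<alpha> (ennreal p)) f \<le> 2 * D"
      using *(2) by linarith
  qed (rule a)
qed

section \<open>Size of functions in Fock spaces\<close>

text \<open>
  Membership in \<open>L\<^sup>a \<inter> L\<^sup>\<infinity>\<close> with both norms at most \<open>B\<close>. Both bounds are recorded, since for
  bounded functions the \<open>L\<^sup>r\<close> estimates for all \<open>r \<ge> a\<close> follow. The sup bound holds at every
  point, because the functions in question are continuous.
\<close>

definition bounded_Lp :: "ennreal \<Rightarrow> real \<Rightarrow> (complex \<Rightarrow> complex) \<Rightarrow> bool" where
  "bounded_Lp a B g \<longleftrightarrow> g \<in> borel_measurable borel \<and> (\<forall>z. cmod (g z) \<le> B) \<and>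
     (a < top \<longrightarrow> (\<integral>\<^sup>+z. ennreal (cmod (g z) powr enn2real a) \<partial>lborel) \<le> ennreal (B powr enn2real a))"

lemma ennreal_ge_1_cases:
  assumes "1 \<le> (q :: ennreal)"
  obtains "q = top" | r where "r \<ge> 1" "q = ennreal r"
  using assms by (cases q) auto

text \<open>
  By the reproducing formula \<open>|f\<^sup>\<sharp>(z)|\<close> is at most the integral of \<open>|f\<^sup>\<sharp>|\<close> against a
  Gaussian bump at \<open>z\<close>. For a function normalised to norm at most 1, the integrand is estimated by
  \<open>x e \<le> e + x\<^sup>q\<close> for \<open>0 \<le> e \<le> 1\<close>, which also shows that the integral exists.
\<close>

lemma fock_pointwise_bound:
  assumes "\<alpha> > 0" "q \<ge> 1" "f \<in> fs_carrier (fock \<alpha> q)"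
  shows "fock_inner \<alpha> f (fock_kernel \<alpha> z) = gauss_weighted \<alpha> f z"
    and "cmod (gauss_weighted \<alpha> f z) \<le> 4 * fs_norm (fock \<alpha> q) f"
proof -
  let ?E = "\<lambda>w. exp (- (\<alpha> / 2) * (cmod (w - z))\<^sup>2)"
  let ?g = "\<lambda>w. cmod (gauss_weighted \<alpha> f w)"
  have f: "f holomorphic_on UNIV"
    using assms by (auto simp: fock_def split: if_splits)
  note [measurable] = measurable_gauss_weighted[OF f, of \<alpha>]
  have E: "has_bochner_integral lborel ?E (pi / (\<alpha> / 2))"
    by (rule has_bochner_integral_gaussian) (use assms in auto)
  then have intE: "integrable lborel ?E" and valE: "(\<integral>w. ?E w \<partial>lborel) = pi / (\<alpha> / 2)"
    by (auto simp: has_bochner_integral_iff)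
  have "fock_inner \<alpha> f (fock_kernel \<alpha> z) = gauss_weighted \<alpha> f z \<and> ?g z \<le> 4 * fs_norm (fock \<alpha> q) f"
  proof (cases "q = top")
    case True
    define N where "N = fs_norm (fock \<alpha> q) f"
    have le: "?g w \<le> N" for w
      using assms unfolding N_def True fock_top by (intro cSUP_upper) auto
    moreover have "0 \<le> ?g z" by simp
    ultimately have "0 \<le> N" by (metis order_trans)
    have "integrable lborel (\<lambda>w. N * ?E w)" using intE by simp
    then have "integrable lborel (\<lambda>w. ?g w * ?E w)"
      by (rule Bochner_Integration.integrable_bound)
         (auto intro!: AE_I2 mult_right_mono simp: le abs_mult \<open>0 \<le> N\<close>)
    from fock_reproducing(1)[OF f assms(1) this] show ?thesis
      using le[of z] \<open>0 \<le> N\<close> by (simp add: N_def)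
  next
    case False
    then obtain r where r: "r \<ge> 1" and q: "q = ennreal r"
      using ennreal_ge_1_cases[OF assms(2)] by metis
    have intg: "integrable lborel (\<lambda>w. ?g w powr r)"
      using assms(3) unfolding q fock_finite[OF r] by simp
    \<comment> \<open>if \<open>x \<le> 1\<close> the first term suffices, otherwise the second\<close>
    have bound: "x * e \<le> e + x powr r" if "0 \<le> x" "0 \<le> e" "e \<le> 1" for x e :: real
    proof (cases "x \<le> 1")
      case True
      then show ?thesis using that mult_right_mono[of x 1 e] by (simp add: add_increasing2)
    next
      case False
      then have "x powr 1 \<le> x powr r" using r by (intro powr_mono) auto
      moreover have "x * e \<le> x" using False that by (simp add: mult_left_le)
      moreover have "x powr 1 = x" using False by simp
      ultimately show ?thesis using that(2) by linarith
    qed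
    have "integrable lborel (\<lambda>w. ?E w + ?g w powr r)"
      using intE intg by simp
    then have intgE: "integrable lborel (\<lambda>w. ?g w * ?E w)"
    proof (rule Bochner_Integration.integrable_bound)
      show "AE w in lborel. norm (?g w * ?E w) \<le> norm (?E w + ?g w powr r)"
      proof (rule AE_I2)
        fix w
        have "?g w * ?E w \<le> ?E w + ?g w powr r"
          using assms(1) by (intro bound) auto
        then show "norm (?g w * ?E w) \<le> norm (?E w + ?g w powr r)"
          by (simp add: abs_mult abs_of_nonneg add_nonneg_nonneg)
      qed
    qed auto
    have "?g z \<le> 4 * n" if n: "n > 0" "fs_norm (fock \<alpha> q) f \<le> n" for n
    proof -
      have N: "(\<integral>w. ?g w powr r \<partial>lborel) \<le> n powr r * (2 * pi / (r * \<alpha>))"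
      proof -
        have "((r * \<alpha> / (2 * pi) * (\<integral>w. ?g w powr r \<partial>lborel)) powr (1 / r)) powr r \<le> n powr r"
          using n(2) r unfolding q fock_finite[OF r] by (intro powr_mono2) auto
        then have "r * \<alpha> / (2 * pi) * (\<integral>w. ?g w powr r \<partial>lborel) \<le> n powr r"
          using r assms(1) by (simp add: powr_powr)
        then show ?thesis using r assms(1) by (simp add: field_simps)
      qed
      have "(\<integral>w. ?g w * ?E w \<partial>lborel) \<le> (\<integral>w. n * (?E w + ?g w powr r / n powr r) \<partial>lborel)"
      proof (rule integral_mono[OF intgE])
        show "integrable lborel (\<lambda>w. n * (?E w + ?g w powr r / n powr r))"
          using intE intg by simp
        fix w
        have "n * (?g w / n * ?E w) \<le> n * (?E w + (?g w / n) powr r)"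
          using n assms(1) by (intro mult_left_mono bound) auto
        then show "?g w * ?E w \<le> n * (?E w + ?g w powr r / n powr r)"
          using n by (simp add: powr_divide)
      qed
      also have "(\<integral>w. n * (?E w + ?g w powr r / n powr r) \<partial>lborel)
          = n * (pi / (\<alpha> / 2) + (\<integral>w. ?g w powr r \<partial>lborel) / n powr r)"
        using intE intg valE by simp
      also have "\<dots> \<le> n * (pi / (\<alpha> / 2) + 2 * pi / (r * \<alpha>))"
        using N n by (intro mult_left_mono add_left_mono) (auto simp: field_simps)
      finally have "\<alpha> / pi * (\<integral>w. ?g w * ?E w \<partial>lborel) \<le> \<alpha> / pi * (n * (pi / (\<alpha> / 2) + 2 * pi / (r * \<alpha>)))"
        using assms(1) by (intro mult_left_mono) auto
      then have "?g z \<le> \<alpha> / pi * (n * (pi / (\<alpha> / 2) + 2 * pi / (r * \<alpha>)))"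
        using fock_reproducing(2)[OF f assms(1) intgE] by (rule order_trans[rotated])
      also have "\<dots> = n * (\<alpha> / pi * (pi / (\<alpha> / 2)) + \<alpha> / pi * (2 * pi / (r * \<alpha>)))"
        by (simp only: distrib_left mult_ac)
      also have "\<dots> = n * (2 + 2 / r)"
      proof -
        have "\<alpha> / pi * (pi / (\<alpha> / 2)) = 2" "\<alpha> / pi * (2 * pi / (r * \<alpha>)) = 2 / r"
          using assms(1) by simp_all
        then show ?thesis by (simp only:)
      qed
      also have "\<dots> \<le> n * 4"
        using n r by (intro mult_left_mono) (auto simp: field_simps)
      finally show ?thesis by simp
    qed
    note bd = this
    have nn: "fs_norm (fock \<alpha> q) f \<ge> 0"
      unfolding q fock_finite[OF r] by (rule powr_ge_zero)
    have "?g z \<le> 4 * fs_norm (fock \<alpha> q) f"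
    proof (rule field_le_epsilon)
      fix e :: real assume "e > 0"
      then have "?g z \<le> 4 * (fs_norm (fock \<alpha> q) f + e / 4)"
        using nn by (intro bd) auto
      then show "?g z \<le> 4 * fs_norm (fock \<alpha> q) f + e"
        by simp
    qed
    with fock_reproducing(1)[OF f assms(1) intgE] show ?thesis
      by (rule conjI)
  qed
  note both = this
  from both show "fock_inner \<alpha> f (fock_kernel \<alpha> z) = gauss_weighted \<alpha> f z"
    by (rule conjunct1)
  from both show "?g z \<le> 4 * fs_norm (fock \<alpha> q) f"
    by (rule conjunct2)
qed

lemma fock_bounded_Lp:
  assumes "\<alpha> > 0" "q \<ge> 1"
  obtains K where "K > 0" "\<And>f. f \<in> fs_carrier (fock \<alpha> q) \<Longrightarrow>
    bounded_Lp q (K * fs_norm (fock \<alpha> q) f) (gauss_weighted \<alpha> f)"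
  using assms(2)
proof (cases rule: ennreal_ge_1_cases)
  case 1
  show ?thesis
    using fock_pointwise_bound(2)[OF assms] 1
    by (intro that[of 4]) (auto simp: bounded_Lp_def fock_top intro!: measurable_gauss_weighted)
next
  case (2 r)
  define c where "c = (r * \<alpha> / (2 * pi))"
  have c: "c > 0" using 2 assms by (simp add: c_def)
  define K where "K = 4 + (1 / c) powr (1 / r)"
  have K: "K \<ge> 4" by (simp add: K_def)
  show ?thesis
  proof (rule that[of K])
    show "K > 0" using K by simp
    fix f assume f: "f \<in> fs_carrier (fock \<alpha> q)"
    define n where "n = fs_norm (fock \<alpha> q) f"
    have n: "n \<ge> 0" by (simp add: n_def 2 fock_finite)
    have hol: "f holomorphic_on UNIV" and int: "integrable lborel (\<lambda>w. cmod (gauss_weighted \<alpha> f w) powr r)"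
      using f 2 by (auto simp: fock_finite)
    define J where "J = (\<integral>w. cmod (gauss_weighted \<alpha> f w) powr r \<partial>lborel)"
    have J: "J \<ge> 0" by (simp add: J_def)
    have "n powr r = c * J"
      unfolding n_def 2(2) fock_finite[OF 2(1)] c_def[symmetric] J_def[symmetric]
      using 2 c J by (simp add: powr_powr)
    then have "J = ((1 / c) powr (1 / r) * n) powr r"
      using 2 c n by (simp add: powr_mult powr_powr field_simps)
    also have "\<dots> \<le> (K * n) powr r"
      using 2 n by (intro powr_mono2 mult_right_mono) (auto simp: K_def)
    finally have "J \<le> (K * n) powr r" .
    moreover have "(\<integral>\<^sup>+w. ennreal (cmod (gauss_weighted \<alpha> f w) powr r) \<partial>lborel) = ennreal J"
      unfolding J_def by (rule nn_integral_eq_integral[OF int]) simp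
    moreover have "cmod (gauss_weighted \<alpha> f z) \<le> K * n" for z
      using fock_pointwise_bound(2)[OF assms f, of z] mult_right_mono[OF K n] by (simp add: n_def)
    ultimately show "bounded_Lp q (K * fs_norm (fock \<alpha> q) f) (gauss_weighted \<alpha> f)"
      unfolding bounded_Lp_def n_def[symmetric] using 2 measurable_gauss_weighted[OF hol]
      by (auto intro: ennreal_leI)
  qed
qed

section \<open>Unit cells\<close>

text \<open>
  Closed unit squares cover the plane and are compact, so that continuous functions attain their
  suprema on them; the open squares are disjoint, so that integrals over them add up.
\<close>

definition unit_cell :: "int \<times> int \<Rightarrow> complex set" where
  "unit_cell i = cbox (Complex (real_of_int (fst i)) (real_of_int (snd i)))
    (Complex (real_of_int (fst i) + 1) (real_of_int (snd i) + 1))"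

definition open_cell :: "int \<times> int \<Rightarrow> complex set" where
  "open_cell i = box (Complex (real_of_int (fst i)) (real_of_int (snd i)))
    (Complex (real_of_int (fst i) + 1) (real_of_int (snd i) + 1))"

lemma mem_unit_cell: "z \<in> unit_cell i \<longleftrightarrow>
    real_of_int (fst i) \<le> Re z \<and> Re z \<le> real_of_int (fst i) + 1 \<and>
    real_of_int (snd i) \<le> Im z \<and> Im z \<le> real_of_int (snd i) + 1"
  by (auto simp: unit_cell_def mem_box Basis_complex_def)

lemma mem_open_cell: "z \<in> open_cell i \<longleftrightarrow>
    real_of_int (fst i) < Re z \<and> Re z < real_of_int (fst i) + 1 \<and>
    real_of_int (snd i) < Im z \<and> Im z < real_of_int (snd i) + 1"
  by (auto simp: open_cell_def mem_box Basis_complex_def)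

lemma emeasure_unit_cell: "emeasure lborel (unit_cell i) = 1" "emeasure lborel (open_cell i) = 1"
  by (simp_all add: unit_cell_def open_cell_def emeasure_lborel_cbox_eq emeasure_lborel_box_eq Basis_complex_def)

lemma UN_unit_cell: "(\<Union>i. unit_cell i) = UNIV"
proof -
  have "z \<in> unit_cell (\<lfloor>Re z\<rfloor>, \<lfloor>Im z\<rfloor>)" for z
    by (simp add: mem_unit_cell)
  then show ?thesis by blast
qed

lemma disjoint_open_cell: "disjoint_family open_cell"
  unfolding disjoint_family_on_def
proof (intro ballI impI)
  fix i j :: "int \<times> int" assume "i \<noteq> j"
  have "i = j" if "z \<in> open_cell i" "z \<in> open_cell j" for z
    using that by (auto simp: mem_open_cell prod_eq_iff)
  then show "open_cell i \<inter> open_cell j = {}" using \<open>i \<noteq> j\<close> by blast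
qed

text \<open>
  A point \<open>Z i\<close> is within distance \<open>\<surd>2\<close> of every \<open>z\<close> in its cell, so
  \<open>|z - w|\<^sup>2 \<le> 4 + 2|w - Z i|\<^sup>2\<close>, and the Gaussian at \<open>Z i\<close> is at most \<open>e\<^sup>\<alpha>\<close> times the integral
  of a wider Gaussian over the cell. Summing over disjoint cells gives an integral over the plane,
  which depends neither on the points nor on \<open>w\<close>.
\<close>

lemma gaussian_sum_bound:
  assumes a: "\<alpha> > 0" and I: "finite I" and Z: "\<And>i. i \<in> I \<Longrightarrow> Z i \<in> unit_cell i"
  shows "(\<Sum>i\<in>I. exp (- (\<alpha> / 2) * (cmod (w - Z i))\<^sup>2)) \<le> exp \<alpha> * (pi / (\<alpha> / 4))"
proof -
  let ?e = "\<lambda>z. ennreal (exp (- (\<alpha> / 4) * (cmod (z - w))\<^sup>2))"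
  have [measurable]: "open_cell i \<in> sets borel" for i by (simp add: open_cell_def)
  have "ennreal (exp (- (\<alpha> / 2) * (cmod (w - Z i))\<^sup>2)) \<le> ennreal (exp \<alpha>) * (\<integral>\<^sup>+z. ?e z * indicator (open_cell i) z \<partial>lborel)"
    if i: "i \<in> I" for i
  proof -
    have "ennreal (exp (- (\<alpha> / 2) * (cmod (w - Z i))\<^sup>2))
        = (\<integral>\<^sup>+z. ennreal (exp (- (\<alpha> / 2) * (cmod (w - Z i))\<^sup>2)) * indicator (open_cell i) z \<partial>lborel)"
      by (simp add: nn_integral_cmult emeasure_unit_cell)
    also have "\<dots> \<le> (\<integral>\<^sup>+z. ennreal (exp \<alpha>) * (?e z * indicator (open_cell i) z) \<partial>lborel)"
    proof (rule nn_integral_mono)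
      fix z
      show "ennreal (exp (- (\<alpha> / 2) * (cmod (w - Z i))\<^sup>2)) * indicator (open_cell i) z
          \<le> ennreal (exp \<alpha>) * (?e z * indicator (open_cell i) z)"
      proof (cases "z \<in> open_cell i")
        case True
        have "\<bar>Re z - Re (Z i)\<bar> \<le> 1" "\<bar>Im z - Im (Z i)\<bar> \<le> 1"
          using True Z[OF i] by (auto simp: mem_open_cell mem_unit_cell)
        then have "(Re z - Re (Z i))\<^sup>2 \<le> 1" "(Im z - Im (Z i))\<^sup>2 \<le> 1"
          by (simp_all add: abs_square_le_1)
        then have d: "(cmod (z - Z i))\<^sup>2 \<le> 2"
          by (simp add: cmod_power2)
        have "(cmod (z - w))\<^sup>2 \<le> (cmod (z - Z i) + cmod (w - Z i))\<^sup>2"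
          by (rule power_mono) (use norm_triangle_ineq4[of "z - Z i" "w - Z i"] in auto)
        also have "\<dots> \<le> 2 * (cmod (z - Z i))\<^sup>2 + 2 * (cmod (w - Z i))\<^sup>2"
          using zero_le_power2[of "cmod (z - Z i) - cmod (w - Z i)"] by (simp add: power2_eq_square algebra_simps)
        finally have "\<alpha> / 4 * (cmod (z - w))\<^sup>2 \<le> \<alpha> / 4 * (4 + 2 * (cmod (w - Z i))\<^sup>2)"
          using a d by (intro mult_left_mono) auto
        then have "exp (- (\<alpha> / 2) * (cmod (w - Z i))\<^sup>2) \<le> exp \<alpha> * exp (- (\<alpha> / 4) * (cmod (z - w))\<^sup>2)"
          by (simp add: exp_add[symmetric] algebra_simps)
        then show ?thesis
          using True by (simp add: ennreal_mult[symmetric])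
      qed simp
    qed
    also have "\<dots> = ennreal (exp \<alpha>) * (\<integral>\<^sup>+z. ?e z * indicator (open_cell i) z \<partial>lborel)"
      by (rule nn_integral_cmult) measurable
    finally show ?thesis .
  qed
  then have "(\<Sum>i\<in>I. ennreal (exp (- (\<alpha> / 2) * (cmod (w - Z i))\<^sup>2)))
      \<le> (\<Sum>i\<in>I. ennreal (exp \<alpha>) * (\<integral>\<^sup>+z. ?e z * indicator (open_cell i) z \<partial>lborel))"
    by (rule sum_mono)
  also have "\<dots> = ennreal (exp \<alpha>) * (\<integral>\<^sup>+z. (\<Sum>i\<in>I. ?e z * indicator (open_cell i) z) \<partial>lborel)"
    by (subst nn_integral_sum) (auto simp: sum_distrib_left)
  also have "\<dots> \<le> ennreal (exp \<alpha>) * (\<integral>\<^sup>+z. ?e z \<partial>lborel)"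
  proof (intro mult_left_mono nn_integral_mono)
    fix z
    have "disjoint_family_on open_cell I"
      using disjoint_open_cell by (rule disjoint_family_on_mono[rotated]) simp
    then have "(\<Sum>i\<in>I. ?e z * indicator (open_cell i) z) = ?e z * indicator (\<Union>i\<in>I. open_cell i) z"
      using I by (simp add: indicator_UN_disjoint sum_distrib_left)
    also have "\<dots> \<le> ?e z" by (simp add: indicator_def)
    finally show "(\<Sum>i\<in>I. ?e z * indicator (open_cell i) z) \<le> ?e z" .
  qed simp
  also have "\<dots> = ennreal (exp \<alpha>) * ennreal (pi / (\<alpha> / 4))"
    using a by (subst nn_integral_gaussian_complex) auto
  finally have "ennreal (\<Sum>i\<in>I. exp (- (\<alpha> / 2) * (cmod (w - Z i))\<^sup>2)) \<le> ennreal (exp \<alpha> * (pi / (\<alpha> / 4)))"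
    using a by (simp add: ennreal_mult[symmetric])
  then show ?thesis
    using a by (subst (asm) ennreal_le_iff) auto
qed

lemma nn_integral_le_cell_sums:
  fixes h :: "complex \<Rightarrow> ennreal"
  assumes [measurable]: "h \<in> borel_measurable borel"
    and h: "\<And>i z. z \<in> unit_cell i \<Longrightarrow> h z \<le> b i"
    and B: "\<And>I. finite I \<Longrightarrow> (\<Sum>i\<in>I. b i) \<le> B"
  shows "(\<integral>\<^sup>+z. h z \<partial>lborel) \<le> B"
proof -
  \<comment> \<open>an enumeration of the cells\<close>
  define e where "e = from_nat_into (UNIV :: (int \<times> int) set)"
  have "infinite (UNIV :: (int \<times> int) set)"
    by (simp add: finite_prod infinite_UNIV_int)
  then have e: "bij e"
    unfolding e_def by (intro bij_betw_from_nat_into) auto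
  have [measurable]: "unit_cell i \<in> sets borel" for i by (simp add: unit_cell_def)
  have "UNIV = (\<Union>n. unit_cell (e n))"
    using UN_unit_cell bij_is_surj[OF e] by (metis image_image)
  then have "(\<integral>\<^sup>+z. h z \<partial>lborel) = emeasure (density lborel h) (\<Union>n. unit_cell (e n))"
    by (simp add: emeasure_density)
  also have "\<dots> \<le> (\<Sum>n. emeasure (density lborel h) (unit_cell (e n)))"
    by (rule emeasure_subadditive_countably) auto
  also have "\<dots> \<le> (\<Sum>n. b (e n))"
  proof (rule suminf_le)
    fix n
    have "emeasure (density lborel h) (unit_cell (e n)) = (\<integral>\<^sup>+z. h z * indicator (unit_cell (e n)) z \<partial>lborel)"
      by (simp add: emeasure_density)
    also have "\<dots> \<le> (\<integral>\<^sup>+z. b (e n) * indicator (unit_cell (e n)) z \<partial>lborel)"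
      by (intro nn_integral_mono) (auto simp: indicator_def h)
    also have "\<dots> = b (e n)"
      by (simp add: nn_integral_cmult emeasure_unit_cell)
    finally show "emeasure (density lborel h) (unit_cell (e n)) \<le> b (e n)" .
  qed auto
  also have "\<dots> \<le> B"
  proof (rule suminf_le_const)
    fix N
    have "(\<Sum>n<N. b (e n)) = (\<Sum>i\<in>e ` {..<N}. b i)"
      using e by (subst sum.reindex) (auto simp: bij_def intro: inj_on_subset)
    then show "(\<Sum>n<N. b (e n)) \<le> B" using B by simp
  qed simp
  finally show ?thesis .
qed

section \<open>Functionals evaluated at kernels\<close>

text \<open>
  Kernels that overlap at most \<open>M\<close>-fold behave like a basis of \<open>\<ell>\<^sup>p\<close> from above. Pointwise, the
  sum is \<open>M\<close> times a weighted mean of the numbers \<open>|c\<^sub>i|\<close>, with weights given by the Gaussian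
  bumps; Jensen's inequality makes the \<open>p\<close>-th power linear in the bumps, and these have known
  integral.
\<close>

lemma fock_kernel_sum_norm:
  assumes a: "\<alpha> > 0" and p: "p \<ge> 1" and I: "finite I" and M: "M > 0"
    and le: "\<And>w. (\<Sum>i\<in>I. exp (- (\<alpha> / 2) * (cmod (w - Z i))\<^sup>2)) \<le> M"
  shows "fs_norm (fock \<alpha> (ennreal p)) (\<lambda>w. \<Sum>i\<in>I. c i * fock_kernel \<alpha> (Z i) w)
    \<le> (p * (M powr p / M) * (\<Sum>i\<in>I. cmod (c i) powr p)) powr (1 / p)"
proof -
  let ?f = "\<lambda>w. \<Sum>i\<in>I. c i * fock_kernel \<alpha> (Z i) w"
  let ?E = "\<lambda>i w. exp (- (\<alpha> / 2) * (cmod (w - Z i))\<^sup>2)"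
  define B where "B = M powr p / M * (\<Sum>i\<in>I. cmod (c i) powr p) * (pi / (\<alpha> / 2))"
  have hol: "?f holomorphic_on UNIV"
    by (intro holomorphic_on_sum holomorphic_on_mult holomorphic_on_const holomorphic_fock_kernel)
  have S: "(\<Sum>i\<in>I. cmod (c i) powr p) \<ge> 0" by (intro sum_nonneg) simp
  have "(\<integral>\<^sup>+z. ennreal (cmod (gauss_weighted \<alpha> ?f z) powr p) \<partial>lborel)
      \<le> (\<integral>\<^sup>+z. (\<Sum>i\<in>I. ennreal (M powr p / M * cmod (c i) powr p) * ennreal (?E i z)) \<partial>lborel)"
  proof (rule nn_integral_mono)
    fix z
    have "cmod (gauss_weighted \<alpha> ?f z) \<le> (\<Sum>i\<in>I. cmod (c i) * ?E i z)"
      unfolding gauss_weighted_sum gauss_weighted_scale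
      using norm_sum[of "\<lambda>i. c i * gauss_weighted \<alpha> (fock_kernel \<alpha> (Z i)) z" I]
      by (simp add: norm_mult norm_gauss_weighted_fock_kernel)
    also have "\<dots> = M * (\<Sum>i\<in>I. (?E i z / M) * cmod (c i))"
      using M by (simp add: sum_distrib_left mult_ac)
    finally have "cmod (gauss_weighted \<alpha> ?f z) powr p \<le> (M * (\<Sum>i\<in>I. (?E i z / M) * cmod (c i))) powr p"
      using p by (intro powr_mono2) auto
    also have "\<dots> = M powr p * (\<Sum>i\<in>I. (?E i z / M) * cmod (c i)) powr p"
      by (rule powr_mult)
    also have "\<dots> \<le> M powr p * (\<Sum>i\<in>I. (?E i z / M) * cmod (c i) powr p)"
      using M le p I by (intro mult_left_mono powr_sum_le_weighted) (auto simp: sum_divide_distrib[symmetric])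
    also have "\<dots> = (\<Sum>i\<in>I. (M powr p / M * cmod (c i) powr p) * ?E i z)"
      by (simp add: sum_distrib_left mult_ac)
    finally have "ennreal (cmod (gauss_weighted \<alpha> ?f z) powr p) \<le> ennreal (\<Sum>i\<in>I. (M powr p / M * cmod (c i) powr p) * ?E i z)"
      by (rule ennreal_leI)
    also have "\<dots> = (\<Sum>i\<in>I. ennreal ((M powr p / M * cmod (c i) powr p) * ?E i z))"
      using M by (intro sum_ennreal[symmetric]) auto
    also have "\<dots> = (\<Sum>i\<in>I. ennreal (M powr p / M * cmod (c i) powr p) * ennreal (?E i z))"
      using M by (intro sum.cong ennreal_mult) auto
    finally show "ennreal (cmod (gauss_weighted \<alpha> ?f z) powr p)
        \<le> (\<Sum>i\<in>I. ennreal (M powr p / M * cmod (c i) powr p) * ennreal (?E i z))" .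
  qed
  also have "\<dots> = (\<Sum>i\<in>I. ennreal (M powr p / M * cmod (c i) powr p) * ennreal (pi / (\<alpha> / 2)))"
    using a nn_integral_gaussian_complex[of "\<alpha> / 2"]
    by (subst nn_integral_sum) (auto intro!: sum.cong simp: nn_integral_cmult)
  also have "\<dots> = (\<Sum>i\<in>I. ennreal (M powr p / M * cmod (c i) powr p * (pi / (\<alpha> / 2))))"
    using a M by (intro sum.cong ennreal_mult[symmetric]) auto
  also have "\<dots> = ennreal (\<Sum>i\<in>I. M powr p / M * cmod (c i) powr p * (pi / (\<alpha> / 2)))"
    using a M by (intro sum_ennreal) auto
  also have "(\<Sum>i\<in>I. M powr p / M * cmod (c i) powr p * (pi / (\<alpha> / 2))) = B"
    by (simp only: B_def sum_distrib_left sum_distrib_right)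
  finally have "fs_norm (fock \<alpha> (ennreal p)) ?f \<le> (p * \<alpha> / (2 * pi) * B) powr (1 / p)"
    using a M S by (intro fock_norm_le_nn_integral(2)[OF p a hol]) (auto simp: B_def)
  also have "p * \<alpha> / (2 * pi) * B = p * (M powr p / M) * (\<Sum>i\<in>I. cmod (c i) powr p)"
    using a by (simp add: B_def)
  finally show ?thesis .
qed

context gauss_weighted_space
begin

lemma measurable_dual_fock_kernel:
  "\<phi> \<in> dual_space X \<Longrightarrow> (\<lambda>z. \<phi> (fock_kernel \<alpha> z)) \<in> borel_measurable borel"
  by (intro borel_measurable_continuous_onI continuous_dual_fock_kernel)

lemma dual_fock_kernel_pointwise:
  assumes "\<phi> \<in> dual_space X" "fs_norm X (fock_kernel \<alpha> z) \<le> L"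
  shows "cmod (\<phi> (fock_kernel \<alpha> z)) \<le> L * dual_norm X \<phi>"
  using dual_norm_bound[OF assms(1) fock_kernel_mem, of z] mult_left_mono[OF assms(2) dual_norm_nonneg[OF assms(1)]]
  by (simp add: mult.commute)

text \<open>
  The integral of \<open>|\<phi>(k\<^sub>z)|\<^sup>P\<close> is at most the sum of the suprema over the cells, and these are
  attained at some choice of points; hence bounds for finite sums, uniform in the choice of one
  point per cell, suffice.
\<close>

lemma bounded_Lp_dual_fock_kernel:
  assumes \<phi>: "\<phi> \<in> dual_space X" and P: "P \<ge> 1"
    and pt: "\<And>z. fs_norm X (fock_kernel \<alpha> z) \<le> L"
    and sums: "\<And>I Z. finite I \<Longrightarrow> (\<And>i. i \<in> I \<Longrightarrow> Z i \<in> unit_cell i) \<Longrightarrow>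
      (\<Sum>i\<in>I. cmod (\<phi> (fock_kernel \<alpha> (Z i))) powr P) \<le> (L * dual_norm X \<phi>) powr P"
  shows "bounded_Lp (ennreal P) (L * dual_norm X \<phi>) (\<lambda>z. \<phi> (fock_kernel \<alpha> z))"
proof -
  let ?G = "\<lambda>z. \<phi> (fock_kernel \<alpha> z)"
  note [measurable] = measurable_dual_fock_kernel[OF \<phi>]
  have "\<exists>x\<in>unit_cell i. \<forall>z\<in>unit_cell i. cmod (?G z) \<le> cmod (?G x)" for i
  proof (rule continuous_attains_sup)
    show "compact (unit_cell i)" by (simp add: unit_cell_def)
    have "Complex (real_of_int (fst i)) (real_of_int (snd i)) \<in> unit_cell i"
      by (simp add: mem_unit_cell)
    then show "unit_cell i \<noteq> {}" by blast
    show "continuous_on (unit_cell i) (\<lambda>z. cmod (?G z))"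
      using continuous_dual_fock_kernel[OF \<phi>] by (intro continuous_on_norm) (rule continuous_on_subset, auto)
  qed
  then obtain Z where Z: "\<And>i. Z i \<in> unit_cell i" "\<And>i z. z \<in> unit_cell i \<Longrightarrow> cmod (?G z) \<le> cmod (?G (Z i))"
    by metis
  have "(\<integral>\<^sup>+z. ennreal (cmod (?G z) powr P) \<partial>lborel) \<le> ennreal ((L * dual_norm X \<phi>) powr P)"
  proof (rule nn_integral_le_cell_sums[where b="\<lambda>i. ennreal (cmod (?G (Z i)) powr P)"])
    fix i z assume "z \<in> unit_cell i"
    then show "ennreal (cmod (?G z) powr P) \<le> ennreal (cmod (?G (Z i)) powr P)"
      using Z(2) P by (intro ennreal_leI powr_mono2) auto
  next
    fix I :: "(int \<times> int) set" assume "finite I"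
    then have "(\<Sum>i\<in>I. cmod (?G (Z i)) powr P) \<le> (L * dual_norm X \<phi>) powr P"
      using Z(1) by (rule sums)
    then show "(\<Sum>i\<in>I. ennreal (cmod (?G (Z i)) powr P)) \<le> ennreal ((L * dual_norm X \<phi>) powr P)"
      by (subst sum_ennreal) (auto intro: ennreal_leI)
  qed measurable
  then show ?thesis
    unfolding bounded_Lp_def using dual_fock_kernel_pointwise[OF \<phi> pt] P by auto
qed

end

lemma cnj_sgn_mult: "cnj (sgn x) * x = of_real (cmod x)"
proof (cases "x = 0")
  case False
  then show ?thesis
    by (simp add: sgn_eq complex_norm_square[symmetric] mult.commute[of "cnj x"] power2_eq_square)
qed simp

text \<open>
  The duality of \<open>c\<^sub>0\<close> and \<open>\<ell>\<^sup>1\<close>: test \<open>\<phi>\<close> on \<open>\<Sum>\<^sub>i c\<^sub>i k\<^bsub>Z i\<^esub>\<close>, where \<open>|c\<^sub>i| \<le> 1\<close> rotates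
  \<open>\<phi>(k\<^bsub>Z i\<^esub>)\<close> to its absolute value. The norm of such a sum is bounded by the overlap of the
  Gaussian bumps.
\<close>

lemma little_fock_dual_L1:
  assumes a: "\<alpha> > 0"
  obtains K where "K > 0" "\<And>\<phi>. \<phi> \<in> dual_space (little_fock \<alpha>) \<Longrightarrow>
    bounded_Lp 1 (K * dual_norm (little_fock \<alpha>) \<phi>) (\<lambda>z. \<phi> (fock_kernel \<alpha> z))"
proof -
  interpret gauss_weighted_space "little_fock \<alpha>" \<alpha>
    by (rule gauss_weighted_space_little_fock[OF a])
  let ?X = "little_fock \<alpha>"
  define M where "M = exp \<alpha> * (pi / (\<alpha> / 4))"
  have norm_sum_le: "fs_norm ?X (\<lambda>w. \<Sum>i\<in>I. c i * fock_kernel \<alpha> (Z i) w) \<le> N"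
    if c: "\<And>i. i \<in> I \<Longrightarrow> cmod (c i) \<le> 1"
      and N: "\<And>w. (\<Sum>i\<in>I. exp (- (\<alpha> / 2) * (cmod (w - Z i))\<^sup>2)) \<le> N" for I :: "'i set" and c Z N
  proof -
    have "cmod (gauss_weighted \<alpha> (\<lambda>w. \<Sum>i\<in>I. c i * fock_kernel \<alpha> (Z i) w) w) \<le> N" for w
    proof -
      have "cmod (gauss_weighted \<alpha> (\<lambda>w. \<Sum>i\<in>I. c i * fock_kernel \<alpha> (Z i) w) w)
          \<le> (\<Sum>i\<in>I. cmod (c i) * exp (- (\<alpha> / 2) * (cmod (w - Z i))\<^sup>2))"
        unfolding gauss_weighted_sum gauss_weighted_scale
        using norm_sum[of "\<lambda>i. c i * gauss_weighted \<alpha> (fock_kernel \<alpha> (Z i)) w" I]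
        by (simp add: norm_mult norm_gauss_weighted_fock_kernel)
      also have "\<dots> \<le> (\<Sum>i\<in>I. 1 * exp (- (\<alpha> / 2) * (cmod (w - Z i))\<^sup>2))"
        using c by (intro sum_mono mult_right_mono) auto
      also have "\<dots> \<le> N" using N[of w] by simp
      finally show ?thesis .
    qed
    then show ?thesis
      unfolding little_fock_def fock_top(2) by (simp add: fock_top(2)) (intro cSUP_least, auto)
  qed
  show ?thesis
  proof (rule that[of "M + 1"])
    show "M + 1 > 0" using a by (simp add: M_def add_pos_pos)
    fix \<phi> assume \<phi>: "\<phi> \<in> dual_space ?X"
    have "bounded_Lp (ennreal 1) ((M + 1) * dual_norm ?X \<phi>) (\<lambda>z. \<phi> (fock_kernel \<alpha> z))"
    proof (rule bounded_Lp_dual_fock_kernel[OF \<phi>])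
      fix z
      have "fs_norm ?X (fock_kernel \<alpha> z) \<le> 1"
        using norm_sum_le[of "{()}" "\<lambda>_. 1" "\<lambda>_. z" 1] a by simp
      also have "1 \<le> M + 1" using a by (simp add: M_def)
      finally show "fs_norm ?X (fock_kernel \<alpha> z) \<le> M + 1" .
    next
      fix I Z assume I: "finite I" "\<And>i. i \<in> I \<Longrightarrow> Z i \<in> unit_cell i"
      let ?c = "\<lambda>i. cnj (sgn (\<phi> (fock_kernel \<alpha> (Z i))))"
      let ?f = "\<lambda>w. \<Sum>i\<in>I. ?c i * fock_kernel \<alpha> (Z i) w"
      have "\<phi> ?f = (\<Sum>i\<in>I. ?c i * \<phi> (fock_kernel \<alpha> (Z i)))"
        by (intro dual_space_sum[OF \<phi> I(1)] fock_kernel_mem)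
      also have "\<dots> = of_real (\<Sum>i\<in>I. cmod (\<phi> (fock_kernel \<alpha> (Z i))))"
        by (simp only: cnj_sgn_mult of_real_sum)
      finally have "(\<Sum>i\<in>I. cmod (\<phi> (fock_kernel \<alpha> (Z i)))) = cmod (\<phi> ?f)"
        by (simp add: sum_nonneg del: of_real_sum)
      also have "\<dots> \<le> dual_norm ?X \<phi> * fs_norm ?X ?f"
        by (intro dual_norm_bound[OF \<phi>] sum_mem I(1) fock_kernel_mem)
      also have "\<dots> \<le> dual_norm ?X \<phi> * (M + 1)"
      proof (intro mult_left_mono dual_norm_nonneg[OF \<phi>] norm_sum_le)
        fix w show "(\<Sum>i\<in>I. exp (- (\<alpha> / 2) * (cmod (w - Z i))\<^sup>2)) \<le> M + 1"
          using gaussian_sum_bound[OF a I, of w] by (simp add: M_def)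
      qed (simp add: norm_sgn)
      finally show "(\<Sum>i\<in>I. cmod (\<phi> (fock_kernel \<alpha> (Z i))) powr 1) \<le> ((M + 1) * dual_norm ?X \<phi>) powr 1"
        using a dual_norm_nonneg[OF \<phi>] by (simp add: M_def mult.commute add_nonneg_nonneg)
    qed simp
    then show "bounded_Lp 1 ((M + 1) * dual_norm ?X \<phi>) (\<lambda>z. \<phi> (fock_kernel \<alpha> z))"
      by simp
  qed
qed

lemma fock_kernel_norm_bound:
  assumes a: "\<alpha> > 0" and p: "p \<ge> 1"
  shows "fs_norm (fock \<alpha> (ennreal p)) (fock_kernel \<alpha> z) \<le> p powr (1 / p)"
  using fock_kernel_sum_norm[OF a p, of "{()}" 1 "\<lambda>_. z" "\<lambda>_. 1"] a by simp

text \<open>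
  The duality of \<open>\<ell>\<^sup>p\<close> and \<open>\<ell>\<^bsup>p'\<^esup>\<close>: with \<open>|c\<^sub>i| = |\<phi>(k\<^bsub>Z i\<^esub>)|\<^bsup>p' - 1\<^esup>\<close> and suitable phases,
  \<open>A = \<Sum>\<^sub>i |\<phi>(k\<^bsub>Z i\<^esub>)|\<^bsup>p'\<^esup>\<close> is the value of \<open>\<phi>\<close> at \<open>\<Sum>\<^sub>i c\<^sub>i k\<^bsub>Z i\<^esub>\<close>, whose norm is at
  most a constant times \<open>A\<^bsup>1/p\<^esup>\<close>. Hence \<open>A\<^bsup>1/p'\<^esup>\<close> is bounded. For \<open>p = 1\<close> only the
  pointwise bound remains.
\<close>

lemma fock_dual_Lp:
  assumes a: "\<alpha> > 0" and p: "1 \<le> p" "p < top" and conj: "1 / p + 1 / p' = 1"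
  obtains K where "K > 0" "\<And>\<phi>. \<phi> \<in> dual_space (fock \<alpha> p) \<Longrightarrow>
    bounded_Lp p' (K * dual_norm (fock \<alpha> p) \<phi>) (\<lambda>z. \<phi> (fock_kernel \<alpha> z))"
proof -
  obtain pr where pr: "pr \<ge> 1" and p_eq: "p = ennreal pr"
    using ennreal_ge_1_cases[OF p(1)] p(2) by auto
  interpret gauss_weighted_space "fock \<alpha> p" \<alpha>
    unfolding p_eq by (rule gauss_weighted_space_fock_finite[OF pr a])
  let ?X = "fock \<alpha> p"
  define N where "N = pr powr (1 / pr)"
  have N: "N > 0" using pr by (simp add: N_def)
  have knorm: "fs_norm ?X (fock_kernel \<alpha> z) \<le> N" for z
    unfolding p_eq N_def by (rule fock_kernel_norm_bound[OF a pr])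
  show ?thesis
  proof (cases p')
    case top
    show ?thesis
      using N dual_fock_kernel_pointwise[OF _ knorm] measurable_dual_fock_kernel
      by (intro that[of N]) (auto simp: bounded_Lp_def top)
  next
    case (real P)
    have "P \<noteq> 0" using conj real by auto
    with real have P0: "P > 0" by simp
    have "ennreal (1 / pr) + ennreal (1 / P) = 1"
      using conj P0 pr real p_eq by (simp add: ennreal_1[symmetric] divide_ennreal del: ennreal_1)
    then have "ennreal (1 / pr + 1 / P) = ennreal 1"
      using pr P0 by (subst ennreal_plus) auto
    then have conj': "1 / pr + 1 / P = 1"
      using pr P0 by (subst (asm) ennreal_inj) auto
    then have p1: "pr > 1" using pr P0 by (cases "pr = 1") auto
    have "1 / pr \<ge> 0" using pr by simp
    then have "1 / P \<le> 1" using conj' by linarith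
    then have P1: "P \<ge> 1" using P0 by simp
    have exps: "(P - 1) * pr = P"
      using conj' P0 p1 by (simp add: field_simps)
    define M where "M = exp \<alpha> * (pi / (\<alpha> / 4))"
    have M: "M > 0" using a by (simp add: M_def)
    define L where "L = (pr * (M powr pr / M)) powr (1 / pr)"
    have L: "L > 0" using M p1 by (simp add: L_def)
    show ?thesis
    proof (rule that[of "L + N"])
      show "L + N > 0" using L N by simp
      fix \<phi> assume \<phi>: "\<phi> \<in> dual_space ?X"
      define d where "d = dual_norm ?X \<phi>"
      have d: "d \<ge> 0" unfolding d_def by (rule dual_norm_nonneg[OF \<phi>])
      have "bounded_Lp (ennreal P) ((L + N) * dual_norm ?X \<phi>) (\<lambda>z. \<phi> (fock_kernel \<alpha> z))"
      proof (rule bounded_Lp_dual_fock_kernel[OF \<phi> P1])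
        fix z show "fs_norm ?X (fock_kernel \<alpha> z) \<le> L + N"
          using knorm[of z] L by linarith
      next
        fix I Z assume I: "finite I" "\<And>i. i \<in> I \<Longrightarrow> Z i \<in> unit_cell i"
        let ?G = "\<lambda>i. \<phi> (fock_kernel \<alpha> (Z i))"
        define A where "A = (\<Sum>i\<in>I. cmod (?G i) powr P)"
        have A0: "A \<ge> 0" unfolding A_def by (intro sum_nonneg) simp
        \<comment> \<open>the extremal sequence for the pairing of \<open>\<ell>\<^sup>p\<close> with \<open>\<ell>\<^bsup>p'\<^esup>\<close>\<close>
        let ?c = "\<lambda>i. of_real (cmod (?G i) powr (P - 1)) * cnj (sgn (?G i))"
        let ?f = "\<lambda>w. \<Sum>i\<in>I. ?c i * fock_kernel \<alpha> (Z i) w"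
        have "\<phi> ?f = (\<Sum>i\<in>I. ?c i * ?G i)"
          by (intro dual_space_sum[OF \<phi> I(1)] fock_kernel_mem)
        also have "\<dots> = (\<Sum>i\<in>I. of_real (cmod (?G i) powr P))"
        proof (rule sum.cong)
          fix i
          have "cmod (?G i) powr (P - 1) * cmod (?G i) = cmod (?G i) powr P"
            by (cases "?G i = 0") (simp_all add: powr_diff)
          then show "?c i * ?G i = of_real (cmod (?G i) powr P)"
            by (simp only: mult.assoc cnj_sgn_mult of_real_mult[symmetric])
        qed simp
        also have "\<dots> = of_real A"
          by (simp add: A_def)
        finally have "A = cmod (\<phi> ?f)"
          using A0 by simp
        also have "\<dots> \<le> d * fs_norm ?X ?f"
          unfolding d_def by (intro dual_norm_bound[OF \<phi>] sum_mem I(1) fock_kernel_mem)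
        also have "fs_norm ?X ?f \<le> (pr * (M powr pr / M) * (\<Sum>i\<in>I. cmod (?c i) powr pr)) powr (1 / pr)"
          unfolding p_eq
          by (rule fock_kernel_sum_norm[OF a pr I(1) M]) (use gaussian_sum_bound[OF a I] in \<open>simp add: M_def\<close>)
        also have "\<dots> \<le> (pr * (M powr pr / M) * A) powr (1 / pr)"
        proof (intro powr_mono2 mult_left_mono mult_nonneg_nonneg sum_nonneg)
          show "(\<Sum>i\<in>I. cmod (?c i) powr pr) \<le> A"
            unfolding A_def
          proof (rule sum_mono)
            fix i
            have "cmod (?c i) \<le> cmod (?G i) powr (P - 1)"
              by (simp add: norm_mult norm_sgn)
            then have "cmod (?c i) powr pr \<le> (cmod (?G i) powr (P - 1)) powr pr"
              using pr by (intro powr_mono2) auto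
            then show "cmod (?c i) powr pr \<le> cmod (?G i) powr P"
              by (simp only: powr_powr exps)
          qed
        qed (use M pr in auto)
        also have "\<dots> = L * A powr (1 / pr)"
          unfolding L_def by (rule powr_mult)
        finally have main: "A \<le> d * (L * A powr (1 / pr))"
          using d by (simp add: mult_left_mono)
        have "A \<le> (L * d) powr P"
        proof (cases "A = 0")
          case False
          then have Ap: "A > 0" using A0 by simp
          have "A powr (1 / P) * A powr (1 / pr) = A"
            using Ap conj' by (simp add: powr_add[symmetric] add.commute)
          then have "A powr (1 / P) * A powr (1 / pr) \<le> (L * d) * A powr (1 / pr)"
            using main by (simp add: mult_ac)
          then have "A powr (1 / P) \<le> L * d"
            using Ap by (simp add: mult_le_cancel_right)
          then have "(A powr (1 / P)) powr P \<le> (L * d) powr P"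
            using P0 by (intro powr_mono2) auto
          then show ?thesis using P0 Ap by (simp add: powr_powr)
        qed simp
        also have "\<dots> \<le> ((L + N) * d) powr P"
          using L N d P0 by (intro powr_mono2 mult_right_mono) auto
        finally show "(\<Sum>i\<in>I. cmod (?G i) powr P) \<le> ((L + N) * dual_norm ?X \<phi>) powr P"
          by (simp only: A_def d_def)
      qed
      then show "bounded_Lp p' ((L + N) * dual_norm ?X \<phi>) (\<lambda>z. \<phi> (fock_kernel \<alpha> z))"
        using real by simp
    qed
  qed
qed

section \<open>Products and sums of bounded integrable functions\<close>

text \<open>
  Integrating the inequality \<open>(x y)\<^sup>r \<le> x\<^sup>a + y\<^sup>b\<close> for functions normalised to take values in
  \<open>[0, 1]\<close> gives Hoelder's inequality up to a factor. Here, of \<open>x\<^sup>a\<close> and \<open>y\<^sup>b\<close>, the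
  former is the larger one, and then \<open>y \<le> x\<^bsup>a/b\<^esup>\<close>.
\<close>

lemma powr_mult_le_sum_aux:
  fixes x y a b r :: real
  assumes x: "0 \<le> x" "x \<le> 1" and y: "0 \<le> y" and pos: "a > 0" "b > 0" "r > 0"
    and r: "1 / r \<le> 1 / a + 1 / b" and le: "y powr b \<le> x powr a"
  shows "(x * y) powr r \<le> x powr a"
proof (cases "x = 0")
  case False
  then have x0: "x > 0" using x by simp
  have "y = (y powr b) powr (1 / b)" using y pos by (simp add: powr_powr)
  also have "\<dots> \<le> (x powr a) powr (1 / b)" using le pos by (intro powr_mono2) auto
  also have "\<dots> = x powr (a / b)" by (simp add: powr_powr)
  finally have "x * y \<le> x powr 1 * x powr (a / b)"
    using x0 by (simp add: mult_left_mono)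
  also have "\<dots> = x powr (1 + a / b)" by (simp only: powr_add)
  finally have "(x * y) powr r \<le> (x powr (1 + a / b)) powr r"
    using x y pos by (intro powr_mono2) auto
  also have "\<dots> = x powr ((1 + a / b) * r)" by (simp add: powr_powr)
  also have "\<dots> \<le> x powr a"
  proof (rule powr_mono')
    have "a * r * (1 / r) \<le> a * r * (1 / a + 1 / b)"
      using r pos by (intro mult_left_mono) auto
    also have "\<dots> = (1 + a / b) * r" using pos by (simp add: field_simps)
    finally show "a \<le> (1 + a / b) * r" using pos by simp
  qed (use x in auto)
  finally show ?thesis .
qed simp

lemma powr_mult_le_sum:
  fixes x y a b r :: real
  assumes "0 \<le> x" "x \<le> 1" "0 \<le> y" "y \<le> 1" "a > 0" "b > 0" "r > 0" "1 / r \<le> 1 / a + 1 / b"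
  shows "(x * y) powr r \<le> x powr a + y powr b"
proof (cases "y powr b \<le> x powr a")
  case True
  then show ?thesis
    using powr_mult_le_sum_aux[of x y a b r] assms by (simp add: add_increasing2)
next
  case False
  then show ?thesis
    using powr_mult_le_sum_aux[of y x b a r] assms by (simp add: add_increasing mult.commute add.commute)
qed

lemma powr_le_powr_of_le_1:
  fixes x y a r :: real
  assumes "0 \<le> x" "x \<le> 1" "0 \<le> y" "y \<le> 1" "a > 0" "r > 0" "1 / r \<le> 1 / a"
  shows "(x * y) powr r \<le> x powr a"
proof -
  have "(x * y) powr r \<le> x powr r"
    using assms by (intro powr_mono2 mult_left_le) auto
  also have "\<dots> \<le> x powr a"
    using assms by (intro powr_mono') (auto simp: field_simps)
  finally show ?thesis .
qed

lemma nn_integral_powr_mult_le: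
  assumes g: "bounded_Lp a A g" and h: "bounded_Lp b B h" and a: "1 \<le> a" and b: "1 \<le> b"
    and r: "r > 0" and abr: "1 / ennreal r \<le> 1 / a + 1 / b"
  shows "(\<integral>\<^sup>+z. ennreal (cmod (g z * h z) powr r) \<partial>lborel) \<le> ennreal (2 * (A * B) powr r)"
proof -
  have [measurable]: "g \<in> borel_measurable borel" "h \<in> borel_measurable borel"
    using g h by (auto simp: bounded_Lp_def)
  have gA: "cmod (g z) \<le> A" and hB: "cmod (h z) \<le> B" for z
    using g h by (auto simp: bounded_Lp_def)
  have "A \<ge> 0" "B \<ge> 0"
    using gA[of 0] hB[of 0] norm_ge_zero order_trans by blast+
  show ?thesis
  proof (cases "A = 0 \<or> B = 0")
    case True
    then have eq: "g z * h z = 0" for z using gA[of z] hB[of z] by auto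
    show ?thesis unfolding eq by simp
  next
    case False
    with \<open>A \<ge> 0\<close> \<open>B \<ge> 0\<close> have pos: "A > 0" "B > 0" by auto
    \<comment> \<open>\<open>\<Theta> e x\<close> is \<open>x\<^sup>e\<close>, and for the infinite exponent it is 0, the limit of \<open>x\<^sup>e\<close> for \<open>x < 1\<close>.\<close>
    define \<Theta> where "\<Theta> = (\<lambda>e (x::real). if e = top then 0 else x powr enn2real e)"
    have Theta_nonneg: "\<Theta> e x \<ge> 0" for e x by (simp add: \<Theta>_def)
    have int_Theta: "(\<integral>\<^sup>+z. ennreal (\<Theta> e (cmod (f z) / C)) \<partial>lborel) \<le> 1"
      if f: "bounded_Lp e C f" and C: "C > 0" for e C f
    proof (cases "e = top")
      case True
      then show ?thesis by (simp add: \<Theta>_def)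
    next
      case False
      have [measurable]: "f \<in> borel_measurable borel" using f by (simp add: bounded_Lp_def)
      have "(\<integral>\<^sup>+z. ennreal (\<Theta> e (cmod (f z) / C)) \<partial>lborel)
          = (\<integral>\<^sup>+z. ennreal (1 / C powr enn2real e) * ennreal (cmod (f z) powr enn2real e) \<partial>lborel)"
        using False C by (intro nn_integral_cong) (simp add: \<Theta>_def powr_divide ennreal_mult[symmetric])
      also have "\<dots> = ennreal (1 / C powr enn2real e) * (\<integral>\<^sup>+z. ennreal (cmod (f z) powr enn2real e) \<partial>lborel)"
        by (rule nn_integral_cmult) measurable
      also have "\<dots> \<le> ennreal (1 / C powr enn2real e) * ennreal (C powr enn2real e)"
        using f False by (intro mult_left_mono) (auto simp: bounded_Lp_def less_top)
      also have "\<dots> = 1"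
        using C by (simp add: ennreal_mult[symmetric])
      finally show ?thesis .
    qed
    have key: "(x * y) powr r \<le> \<Theta> a x + \<Theta> b y" if xy: "0 \<le> x" "x \<le> 1" "0 \<le> y" "y \<le> 1" for x y
      using a
    proof (cases rule: ennreal_ge_1_cases)
      case a: 1
      from b show ?thesis
      proof (cases rule: ennreal_ge_1_cases)
        case 1
        then show ?thesis using abr a r by (simp add: divide_ennreal[of 1, simplified])
      next
        case (2 b')
        have "ennreal (1 / r) \<le> ennreal (1 / b')"
          using abr a r 2 by (simp add: divide_ennreal[of 1, simplified])
        then have "1 / r \<le> 1 / b'" using 2 by (subst (asm) ennreal_le_iff) auto
        then show ?thesis
          using powr_le_powr_of_le_1[of y x b' r] xy 2 r a by (simp add: \<Theta>_def mult.commute)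
      qed
    next
      case a: (2 a')
      from b show ?thesis
      proof (cases rule: ennreal_ge_1_cases)
        case 1
        have "ennreal (1 / r) \<le> ennreal (1 / a')"
          using abr a r 1 by (simp add: divide_ennreal[of 1, simplified])
        then have "1 / r \<le> 1 / a'" using a by (subst (asm) ennreal_le_iff) auto
        then show ?thesis
          using powr_le_powr_of_le_1[of x y a' r] xy 1 r a by (simp add: \<Theta>_def)
      next
        case (2 b')
        have "ennreal (1 / r) \<le> ennreal (1 / a') + ennreal (1 / b')"
          using abr a r 2 by (simp add: divide_ennreal[of 1, simplified])
        then have "ennreal (1 / r) \<le> ennreal (1 / a' + 1 / b')"
          using a 2 by (subst ennreal_plus) auto
        then have "1 / r \<le> 1 / a' + 1 / b'" using a 2 by (subst (asm) ennreal_le_iff) auto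
        then show ?thesis
          using powr_mult_le_sum[of x y a' b' r] xy 2 r a by (simp add: \<Theta>_def)
      qed
    qed
    have "(\<integral>\<^sup>+z. ennreal (cmod (g z * h z) powr r) \<partial>lborel)
        \<le> (\<integral>\<^sup>+z. ennreal ((A * B) powr r) * (ennreal (\<Theta> a (cmod (g z) / A)) + ennreal (\<Theta> b (cmod (h z) / B))) \<partial>lborel)"
    proof (rule nn_integral_mono)
      fix z
      have "cmod (g z * h z) powr r = ((A * B) * ((cmod (g z) / A) * (cmod (h z) / B))) powr r"
        using pos by (simp add: norm_mult)
      also have "\<dots> = (A * B) powr r * ((cmod (g z) / A) * (cmod (h z) / B)) powr r"
        by (rule powr_mult)
      also have "\<dots> \<le> (A * B) powr r * (\<Theta> a (cmod (g z) / A) + \<Theta> b (cmod (h z) / B))"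
        using pos gA hB by (intro mult_left_mono key) auto
      finally show "ennreal (cmod (g z * h z) powr r)
          \<le> ennreal ((A * B) powr r) * (ennreal (\<Theta> a (cmod (g z) / A)) + ennreal (\<Theta> b (cmod (h z) / B)))"
        by (simp add: ennreal_mult[symmetric] ennreal_plus[symmetric] Theta_nonneg ennreal_leI del: ennreal_plus)
    qed
    also have "\<dots> = ennreal ((A * B) powr r) * ((\<integral>\<^sup>+z. ennreal (\<Theta> a (cmod (g z) / A)) \<partial>lborel) + (\<integral>\<^sup>+z. ennreal (\<Theta> b (cmod (h z) / B)) \<partial>lborel))"
      unfolding \<Theta>_def by (subst nn_integral_cmult, measurable, subst nn_integral_add) auto
    also have "\<dots> \<le> ennreal ((A * B) powr r) * (1 + 1)"
      using int_Theta g h pos by (intro mult_left_mono add_mono) auto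
    also have "\<dots> = ennreal (2 * (A * B) powr r)"
      by (simp add: ennreal_mult mult.commute)
    finally show ?thesis .
  qed
qed

lemma Lr_norm_le:
  assumes r: "1 \<le> r" and C: "C \<ge> 0" and [measurable]: "f \<in> borel_measurable borel"
    and sup: "r = top \<Longrightarrow> (\<And>z. cmod (f z) \<le> C)"
    and int: "r < top \<Longrightarrow> (\<integral>\<^sup>+z. ennreal (cmod (f z) powr enn2real r) \<partial>lborel) \<le> ennreal (C powr enn2real r)"
  shows "f \<in> Lr_space r \<and> Lr_norm r f \<le> C"
  using r
proof (cases rule: ennreal_ge_1_cases)
  case 1
  have "esssup lborel (\<lambda>z. ennreal (cmod (f z))) \<le> ennreal C"
    using sup[OF 1] by (intro esssup_I) (auto intro: ennreal_leI)
  then show ?thesis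
    using 1 C by (auto simp: Lr_space_def Lr_norm_def intro: enn2real_leI le_less_trans)
next
  case (2 r')
  have le: "(\<integral>\<^sup>+z. ennreal (cmod (f z) powr r') \<partial>lborel) \<le> ennreal (C powr r')"
    using int 2 by simp
  then have fin: "(\<integral>\<^sup>+z. ennreal (norm (cmod (f z) powr r')) \<partial>lborel) < top"
    by (simp add: le_less_trans)
  have i: "integrable lborel (\<lambda>z. cmod (f z) powr r')"
    using fin by (simp add: integrable_iff_bounded)
  have "(\<integral>z. cmod (f z) powr r' \<partial>lborel) \<le> C powr r'"
    using le by (subst (asm) nn_integral_eq_integral[OF i]) (auto simp: ennreal_le_iff)
  then have "(\<integral>z. cmod (f z) powr r' \<partial>lborel) powr (1 / r') \<le> (C powr r') powr (1 / r')"
    using 2 by (intro powr_mono2) auto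
  then show ?thesis
    using 2 C i by (simp add: Lr_space_def Lr_norm_def powr_powr)
qed

text \<open>
  Minkowski's inequality for \<open>r\<close>-th powers of norms: Jensen's inequality with the weights
  \<open>t\<^sub>j / S\<close>, applied to \<open>u\<^sub>j / t\<^sub>j\<close> and then integrated.
\<close>

lemma nn_integral_powr_sum_le:
  fixes u :: "nat \<Rightarrow> complex \<Rightarrow> complex"
  assumes [measurable]: "\<And>j. u j \<in> borel_measurable borel" and r: "r \<ge> 1" and S: "S > 0"
    and t: "\<And>j. t j \<ge> 0" "(\<Sum>j<n. t j) \<le> S" and zero: "\<And>j z. t j = 0 \<Longrightarrow> u j z = 0"
    and int: "\<And>j. (\<integral>\<^sup>+z. ennreal (cmod (u j z) powr r) \<partial>lborel) \<le> ennreal (C * t j powr r)" and C: "C \<ge> 0"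
  shows "(\<integral>\<^sup>+z. ennreal (cmod (\<Sum>j<n. u j z) powr r) \<partial>lborel) \<le> ennreal (C * S powr r)"
proof -
  define v where "v = (\<lambda>j z. cmod (u j z) / t j)"
  have v: "cmod (u j z) = t j * v j z" for j z
    using zero[of j z] by (simp add: v_def)
  have v0: "v j z \<ge> 0" for j z using t by (simp add: v_def)
  have [measurable]: "v j \<in> borel_measurable borel" for j unfolding v_def by measurable
  have intv: "ennreal (t j) * (\<integral>\<^sup>+z. ennreal (v j z powr r) \<partial>lborel) \<le> ennreal (t j * C)" for j
  proof (cases "t j = 0")
    case False
    then have tj: "t j > 0" using t(1)[of j] by simp
    have "(\<integral>\<^sup>+z. ennreal (v j z powr r) \<partial>lborel)
        = (\<integral>\<^sup>+z. ennreal (1 / t j powr r) * ennreal (cmod (u j z) powr r) \<partial>lborel)"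
      using tj by (intro nn_integral_cong) (simp add: v_def powr_divide ennreal_mult[symmetric])
    also have "\<dots> = ennreal (1 / t j powr r) * (\<integral>\<^sup>+z. ennreal (cmod (u j z) powr r) \<partial>lborel)"
      by (rule nn_integral_cmult) measurable
    also have "\<dots> \<le> ennreal (1 / t j powr r) * ennreal (C * t j powr r)"
      by (intro mult_left_mono int) simp
    also have "\<dots> = ennreal C"
      using tj C by (simp add: ennreal_mult[symmetric])
    finally show ?thesis
      using tj C by (simp add: ennreal_mult mult_left_mono)
  qed simp
  have "(\<integral>\<^sup>+z. ennreal (cmod (\<Sum>j<n. u j z) powr r) \<partial>lborel)
      \<le> (\<integral>\<^sup>+z. ennreal (S powr r / S) * (\<Sum>j<n. ennreal (t j) * ennreal (v j z powr r)) \<partial>lborel)"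
  proof (rule nn_integral_mono)
    fix z
    have "cmod (\<Sum>j<n. u j z) \<le> (\<Sum>j<n. t j * v j z)"
      using norm_sum[of "\<lambda>j. u j z" "{..<n}"] by (simp add: v)
    also have "\<dots> = S * (\<Sum>j<n. (t j / S) * v j z)"
      using S by (simp add: sum_distrib_left)
    finally have "cmod (\<Sum>j<n. u j z) powr r \<le> (S * (\<Sum>j<n. (t j / S) * v j z)) powr r"
      using r by (intro powr_mono2) auto
    also have "\<dots> = S powr r * (\<Sum>j<n. (t j / S) * v j z) powr r"
      by (rule powr_mult)
    also have "\<dots> \<le> S powr r * (\<Sum>j<n. (t j / S) * v j z powr r)"
      using S t r v0 by (intro mult_left_mono powr_sum_le_weighted) (auto simp: sum_divide_distrib[symmetric])
    also have "\<dots> = S powr r / S * (\<Sum>j<n. t j * v j z powr r)"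
      by (simp add: sum_distrib_left)
    finally have "ennreal (cmod (\<Sum>j<n. u j z) powr r) \<le> ennreal (S powr r / S * (\<Sum>j<n. t j * v j z powr r))"
      by (rule ennreal_leI)
    also have "\<dots> = ennreal (S powr r / S) * ennreal (\<Sum>j<n. t j * v j z powr r)"
      using S t by (intro ennreal_mult sum_nonneg) auto
    also have "ennreal (\<Sum>j<n. t j * v j z powr r) = (\<Sum>j<n. ennreal (t j) * ennreal (v j z powr r))"
      using t by (simp add: sum_ennreal[symmetric] ennreal_mult)
    finally show "ennreal (cmod (\<Sum>j<n. u j z) powr r)
        \<le> ennreal (S powr r / S) * (\<Sum>j<n. ennreal (t j) * ennreal (v j z powr r))" .
  qed
  also have "\<dots> = ennreal (S powr r / S) * (\<Sum>j<n. ennreal (t j) * (\<integral>\<^sup>+z. ennreal (v j z powr r) \<partial>lborel))"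
    by (subst nn_integral_cmult, measurable, subst nn_integral_sum)
       (auto simp: nn_integral_cmult)
  also have "\<dots> \<le> ennreal (S powr r / S) * (\<Sum>j<n. ennreal (t j * C))"
    by (intro mult_left_mono sum_mono intv) simp
  also have "(\<Sum>j<n. ennreal (t j * C)) = ennreal ((\<Sum>j<n. t j) * C)"
    using t C by (simp add: sum_ennreal sum_distrib_right)
  also have "ennreal (S powr r / S) * \<dots> = ennreal (S powr r / S * ((\<Sum>j<n. t j) * C))"
    using S t C by (intro ennreal_mult[symmetric] mult_nonneg_nonneg sum_nonneg) auto
  also have "\<dots> \<le> ennreal (S powr r / S * (S * C))"
    using S t C by (intro ennreal_leI mult_left_mono mult_right_mono) auto
  also have "S powr r / S * (S * C) = C * S powr r"
    using S by simp
  finally show ?thesis .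
qed

section \<open>The Berezin transform of nuclear operators\<close>

text \<open>
  Convergence in the norm of \<open>F\<^sup>q\<close> implies pointwise convergence, and at the point \<open>z\<close> the
  inner product with \<open>k\<^sub>z\<close> is weighted evaluation.
\<close>

lemma berezin_of_nuclear_rep:
  assumes X: "gauss_weighted_space X \<alpha>" and q: "1 \<le> q"
    and T: "T \<in> bounded_ops X (fock \<alpha> q)" and rep: "nuclear_rep X (fock \<alpha> q) T \<phi> y"
  shows "(\<lambda>n. \<Sum>j<n. \<phi> j (fock_kernel \<alpha> z) * gauss_weighted \<alpha> (y j) z) \<longlonglongrightarrow> berezin \<alpha> T z"
proof -
  interpret X: gauss_weighted_space X \<alpha> by (rule X)
  note a = X.alpha_pos
  interpret Y: normed_fun_space "fock \<alpha> q"
    using q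
  proof (cases rule: ennreal_ge_1_cases)
    case 1
    then show "normed_fun_space (fock \<alpha> q)" using normed_fun_space_fock_top by simp
  next
    case 2
    then show "normed_fun_space (fock \<alpha> q)" using normed_fun_space_fock_finite a by simp
  qed
  let ?k = "fock_kernel \<alpha> z"
  let ?R = "\<lambda>n w. T ?k w - (\<Sum>j<n. \<phi> j ?k * y j w)"
  have k: "?k \<in> fs_carrier X" by (rule X.fock_kernel_mem)
  have Tk: "T ?k \<in> fs_carrier (fock \<alpha> q)" using T k by (auto simp: bounded_ops_def)
  have y: "y j \<in> fs_carrier (fock \<alpha> q)" for j using rep by (auto simp: nuclear_rep_def)
  have mem: "?R n \<in> fs_carrier (fock \<alpha> q)" for n
    by (intro Y.diff_mem Tk Y.sum_mem y) simp
  have lim: "(\<lambda>n. fs_norm (fock \<alpha> q) (?R n)) \<longlonglongrightarrow> 0"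
    using rep k by (auto simp: nuclear_rep_def)
  have "(\<lambda>n. gauss_weighted \<alpha> (?R n) z) \<longlonglongrightarrow> 0"
  proof (rule Lim_null_comparison)
    show "\<forall>\<^sub>F n in sequentially. cmod (gauss_weighted \<alpha> (?R n) z) \<le> 4 * fs_norm (fock \<alpha> q) (?R n)"
      using fock_pointwise_bound(2)[OF a q mem] by simp
    show "(\<lambda>n. 4 * fs_norm (fock \<alpha> q) (?R n)) \<longlonglongrightarrow> 0"
      using tendsto_mult_left[OF lim, of 4] by simp
  qed
  moreover have "gauss_weighted \<alpha> (?R n) z
      = berezin \<alpha> T z - (\<Sum>j<n. \<phi> j ?k * gauss_weighted \<alpha> (y j) z)" for n
    unfolding gauss_weighted_diff gauss_weighted_sum gauss_weighted_scale berezin_def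
    by (simp add: fock_pointwise_bound(1)[OF a q Tk])
  ultimately have "(\<lambda>n. berezin \<alpha> T z - (berezin \<alpha> T z - (\<Sum>j<n. \<phi> j ?k * gauss_weighted \<alpha> (y j) z)))
      \<longlonglongrightarrow> berezin \<alpha> T z - 0"
    by (intro tendsto_diff tendsto_const) simp
  then show ?thesis by simp
qed

text \<open>
  The common form of the three cases. Each term of the series satisfies an \<open>L\<^sup>r\<close> bound
  proportional to \<open>t\<^sub>j = \<parallel>\<phi>\<^sub>j\<parallel> \<parallel>y\<^sub>j\<parallel>\<close>; partial sums inherit it, and Fatou's lemma carries it to the
  limit. The number \<open>S\<close> strictly above \<open>\<Sum>\<^sub>j t\<^sub>j\<close> is positive even if all \<open>t\<^sub>j\<close> vanish, so it may be
  divided by; it is removed when passing to the infimum over all representations.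
\<close>

lemma berezin_nuclear_bound:
  assumes X: "gauss_weighted_space X \<alpha>" and a: "1 \<le> a" and q: "1 \<le> q" and r: "1 \<le> r"
    and dual: "K > 0" "\<And>\<phi>. \<phi> \<in> dual_space X \<Longrightarrow>
      bounded_Lp a (K * dual_norm X \<phi>) (\<lambda>z. \<phi> (fock_kernel \<alpha> z))"
    and arq: "1 / r \<le> 1 / a + 1 / q"
  shows "\<exists>c>0. \<forall>T\<in>nuclear_ops X (fock \<alpha> q).
    berezin \<alpha> T \<in> Lr_space r \<and> Lr_norm r (berezin \<alpha> T) \<le> c * nuclear_norm X (fock \<alpha> q) T"
proof -
  interpret X: gauss_weighted_space X \<alpha> by (rule X)
  let ?Y = "fock \<alpha> q"
  note alpha = X.alpha_pos
  obtain K' where K': "K' > 0" "\<And>f. f \<in> fs_carrier ?Y \<Longrightarrow> bounded_Lp q (K' * fs_norm ?Y f) (gauss_weighted \<alpha> f)"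
    using fock_bounded_Lp[OF alpha q] by blast
  \<comment> \<open>The factor 2 is what the elementary inequality loses against Hoelder; it bounds \<open>2\<^bsup>1/r\<^esup>\<close>.\<close>
  define c where "c = 2 * (K * K')"
  have c: "c > 0" using dual K' by (simp add: c_def)
  have bound: "berezin \<alpha> T \<in> Lr_space r \<and> Lr_norm r (berezin \<alpha> T) \<le> c * S"
    if T: "T \<in> bounded_ops X ?Y" and rep: "nuclear_rep X ?Y T \<phi> y"
      and S: "(\<Sum>j. dual_norm X (\<phi> j) * fs_norm ?Y (y j)) < S" for T \<phi> y S
  proof -
    define t where "t = (\<lambda>j. dual_norm X (\<phi> j) * fs_norm ?Y (y j))"
    define u where "u = (\<lambda>j z. \<phi> j (fock_kernel \<alpha> z) * gauss_weighted \<alpha> (y j) z)"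
    have G: "bounded_Lp a (K * dual_norm X (\<phi> j)) (\<lambda>z. \<phi> j (fock_kernel \<alpha> z))"
      and h: "bounded_Lp q (K' * fs_norm ?Y (y j)) (gauss_weighted \<alpha> (y j))" for j
      using dual(2) K'(2) rep by (auto simp: nuclear_rep_def)
    have lim: "(\<lambda>n. \<Sum>j<n. u j z) \<longlonglongrightarrow> berezin \<alpha> T z" for z
      unfolding u_def by (rule berezin_of_nuclear_rep[OF X q T rep])
    have [measurable]: "u j \<in> borel_measurable borel" for j
      using G[of j] h[of j] unfolding u_def by (auto simp: bounded_Lp_def)
    have u_le: "cmod (u j z) \<le> K * K' * t j" for j z
    proof -
      have "cmod (u j z) \<le> (K * dual_norm X (\<phi> j)) * (K' * fs_norm ?Y (y j))"
        using G[of j] h[of j] unfolding u_def norm_mult bounded_Lp_def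
        by (intro mult_mono) (auto intro: order_trans[OF norm_ge_zero])
      then show ?thesis by (simp add: t_def mult_ac)
    qed
    have t0: "t j \<ge> 0" for j
      using order_trans[OF norm_ge_zero u_le[of j 0]] mult_pos_pos[OF dual(1) K'(1)]
      by (auto simp only: zero_le_mult_iff)
    have summ: "summable t" using rep by (auto simp: nuclear_rep_def t_def)
    have tS: "(\<Sum>j<n. t j) \<le> S" for n
      using sum_le_suminf[OF summ, of "{..<n}"] t0 S by (simp add: t_def)
    have "0 \<le> suminf t" using suminf_nonneg[OF summ] t0 by simp
    then have S0: "S > 0" using S by (simp add: t_def)
    have [measurable]: "berezin \<alpha> T \<in> borel_measurable borel"
      by (rule borel_measurable_LIMSEQ_metric[OF _ lim]) measurable
    show ?thesis
    proof (rule Lr_norm_le[OF r])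
      show "c * S \<ge> 0" using c S0 by simp
      fix z assume "r = top"
      have "cmod (berezin \<alpha> T z) \<le> K * K' * S"
      proof (rule LIMSEQ_le_const2[OF tendsto_norm[OF lim]])
        have "cmod (\<Sum>j<n. u j z) \<le> K * K' * S" for n
        proof -
          have "cmod (\<Sum>j<n. u j z) \<le> (\<Sum>j<n. K * K' * t j)"
            using u_le by (intro order_trans[OF norm_sum] sum_mono) auto
          also have "\<dots> = K * K' * (\<Sum>j<n. t j)" by (simp add: sum_distrib_left)
          also have "\<dots> \<le> K * K' * S" using tS dual(1) K'(1) by (intro mult_left_mono) auto
          finally show ?thesis .
        qed
        then show "\<exists>N. \<forall>n\<ge>N. cmod (\<Sum>j<n. u j z) \<le> K * K' * S" by blast
      qed
      also have "\<dots> \<le> c * S" using S0 dual(1) K'(1) by (simp add: c_def)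
      finally show "cmod (berezin \<alpha> T z) \<le> c * S" .
    next
      assume "r < top"
      then obtain r' where r': "r' \<ge> 1" "r = ennreal r'"
        using ennreal_ge_1_cases[OF r] by auto
      have int: "(\<integral>\<^sup>+z. ennreal (cmod (\<Sum>j<n. u j z) powr r') \<partial>lborel) \<le> ennreal (2 * (K * K') powr r' * S powr r')" for n
      proof (rule nn_integral_powr_sum_le[OF _ r'(1) S0 t0 tS])
        fix j
        show "u j z = 0" if "t j = 0" for z using u_le[of j z] that by simp
        have "(\<integral>\<^sup>+z. ennreal (cmod (u j z) powr r') \<partial>lborel)
            \<le> ennreal (2 * ((K * dual_norm X (\<phi> j)) * (K' * fs_norm ?Y (y j))) powr r')"
          unfolding u_def using r' arq by (intro nn_integral_powr_mult_le[OF G h a q]) auto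
        also have "(K * dual_norm X (\<phi> j)) * (K' * fs_norm ?Y (y j)) = (K * K') * t j"
          by (simp add: t_def mult_ac)
        also have "2 * ((K * K') * t j) powr r' = 2 * (K * K') powr r' * t j powr r'"
          by (simp only: powr_mult mult.assoc)
        finally show "(\<integral>\<^sup>+z. ennreal (cmod (u j z) powr r') \<partial>lborel) \<le> ennreal (2 * (K * K') powr r' * t j powr r')" .
      qed auto
      have "(\<integral>\<^sup>+z. ennreal (cmod (berezin \<alpha> T z) powr r') \<partial>lborel)
          = (\<integral>\<^sup>+z. liminf (\<lambda>n. ennreal (cmod (\<Sum>j<n. u j z) powr r')) \<partial>lborel)"
      proof (rule nn_integral_cong)
        fix z
        have "(\<lambda>n. ennreal (cmod (\<Sum>j<n. u j z) powr r')) \<longlonglongrightarrow> ennreal (cmod (berezin \<alpha> T z) powr r')"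
          using r' by (intro tendsto_ennrealI tendsto_powr' tendsto_norm lim tendsto_const) auto
        then show "ennreal (cmod (berezin \<alpha> T z) powr r') = liminf (\<lambda>n. ennreal (cmod (\<Sum>j<n. u j z) powr r'))"
          using lim_imp_Liminf[of sequentially] by (metis sequentially_bot)
      qed
      also have "\<dots> \<le> liminf (\<lambda>n. \<integral>\<^sup>+z. ennreal (cmod (\<Sum>j<n. u j z) powr r') \<partial>lborel)"
        by (rule nn_integral_liminf) measurable
      also have "\<dots> \<le> ennreal (2 * (K * K') powr r' * S powr r')"
        using int by (intro order_trans[OF Liminf_le_Limsup] Limsup_bounded) auto
      also have "\<dots> \<le> ennreal ((c * S) powr r')"
      proof (rule ennreal_leI)
        have "2 * (K * K') powr r' * S powr r' \<le> 2 powr r' * (K * K') powr r' * S powr r'"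
          using r' powr_mono[of 1 r' 2] by (intro mult_right_mono) auto
        then show "2 * (K * K') powr r' * S powr r' \<le> (c * S) powr r'"
          by (simp only: c_def powr_mult)
      qed
      finally show "(\<integral>\<^sup>+z. ennreal (cmod (berezin \<alpha> T z) powr enn2real r) \<partial>lborel)
          \<le> ennreal ((c * S) powr enn2real r)"
        using r' by simp
    qed measurable
  qed
  show ?thesis
  proof (intro exI[of _ c] conjI ballI)
    show "c > 0" by (rule c)
    fix T assume "T \<in> nuclear_ops X ?Y"
    then have T: "T \<in> bounded_ops X ?Y" and ex: "\<exists>\<phi> y. nuclear_rep X ?Y T \<phi> y"
      by (auto simp: nuclear_ops_def)
    from ex obtain \<phi>0 y0 where rep0: "nuclear_rep X ?Y T \<phi>0 y0" by blast
    show "berezin \<alpha> T \<in> Lr_space r"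
      using bound[OF T rep0 less_add_one] by blast
    have "Lr_norm r (berezin \<alpha> T) / c \<le> nuclear_norm X ?Y T"
      unfolding nuclear_norm_def
    proof (rule cInf_greatest)
      show "{(\<Sum>j. dual_norm X (\<phi> j) * fs_norm ?Y (y j)) | \<phi> y. nuclear_rep X ?Y T \<phi> y} \<noteq> {}"
        using rep0 by blast
      fix x assume "x \<in> {(\<Sum>j. dual_norm X (\<phi> j) * fs_norm ?Y (y j)) | \<phi> y. nuclear_rep X ?Y T \<phi> y}"
      then obtain \<phi> y where x: "x = (\<Sum>j. dual_norm X (\<phi> j) * fs_norm ?Y (y j))" and rep: "nuclear_rep X ?Y T \<phi> y"
        by blast
      show "Lr_norm r (berezin \<alpha> T) / c \<le> x"
      proof (rule field_le_epsilon)
        fix e :: real assume "e > 0"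
        then have "Lr_norm r (berezin \<alpha> T) \<le> c * (x + e)"
          using bound[OF T rep, of "x + e"] by (simp add: x)
        then show "Lr_norm r (berezin \<alpha> T) / c \<le> x + e"
          using c by (simp add: field_simps)
      qed
    qed
    then show "Lr_norm r (berezin \<alpha> T) \<le> c * nuclear_norm X ?Y T"
      using c by (simp add: field_simps)
  qed
qed

lemma inverse_inverse_ennreal: "inverse (inverse x) = (x :: ennreal)"
proof (cases x)
  case (real r)
  then show ?thesis by (cases "r = 0") (auto simp: inverse_ennreal)
qed simp

lemma inverse_ennreal_antimono:
  assumes "x \<le> y"
  shows "inverse y \<le> inverse (x :: ennreal)"
proof (cases "x = 0 \<or> y = top")
  case False
  with assms obtain a b where "x = ennreal a" "y = ennreal b" "0 < a" "a \<le> b"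
    by (cases x; cases y) (auto simp: top_unique ennreal_le_iff)
  then show ?thesis by (simp add: inverse_ennreal ennreal_leI le_imp_inverse_le)
qed auto

theorem theorem3p2:
  fixes \<alpha> :: real and p p' q s :: ennreal
  assumes "\<alpha> > 0" and "1 \<le> p" and "p < top" and "1 \<le> q" and "1 \<le> s"
    and "1 / p + 1 / p' = 1"
  shows
    "(\<forall>r\<ge>1. \<exists>c>0. \<forall>T\<in>nuclear_ops (little_fock \<alpha>) (fock \<alpha> s).
        berezin \<alpha> T \<in> Lr_space r \<and>
        Lr_norm r (berezin \<alpha> T) \<le> c * nuclear_norm (little_fock \<alpha>) (fock \<alpha> s) T) \<and>
     (p \<le> q \<longrightarrow>
       (\<forall>r\<ge>inverse (1 / p' + 1 / q). \<exists>c>0. \<forall>T\<in>nuclear_ops (fock \<alpha> p) (fock \<alpha> q).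
        berezin \<alpha> T \<in> Lr_space r \<and>
        Lr_norm r (berezin \<alpha> T) \<le> c * nuclear_norm (fock \<alpha> p) (fock \<alpha> q) T)) \<and>
     (p > q \<longrightarrow>
       (\<forall>r\<ge>1. \<exists>c>0. \<forall>T\<in>nuclear_ops (fock \<alpha> p) (fock \<alpha> q).
        berezin \<alpha> T \<in> Lr_space r \<and>
        Lr_norm r (berezin \<alpha> T) \<le> c * nuclear_norm (fock \<alpha> p) (fock \<alpha> q) T))"
proof -
  have inv: "1 / x = inverse x" for x :: ennreal
    by (simp add: divide_ennreal_def)
  have inv_le_1: "1 / x \<le> 1" if "1 \<le> x" for x :: ennreal
    using inverse_ennreal_antimono[OF that] by (simp add: inv)
  have p': "1 \<le> p'"
  proof -
    have "inverse p' \<le> 1" using assms(6) unfolding inv by (metis add.commute le_iff_add)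
    then have "inverse 1 \<le> inverse (inverse p')" by (rule inverse_ennreal_antimono)
    then show ?thesis by (simp add: inverse_inverse_ennreal)
  qed
  have X: "gauss_weighted_space (fock \<alpha> p) \<alpha>"
    using assms(2,3) gauss_weighted_space_fock_finite[OF _ assms(1)] by (cases rule: ennreal_ge_1_cases) auto
  obtain K where K: "K > 0" "\<And>\<phi>. \<phi> \<in> dual_space (fock \<alpha> p) \<Longrightarrow>
      bounded_Lp p' (K * dual_norm (fock \<alpha> p) \<phi>) (\<lambda>z. \<phi> (fock_kernel \<alpha> z))"
    using fock_dual_Lp[OF assms(1-3,6)] by blast
  obtain K1 where K1: "K1 > 0" "\<And>\<phi>. \<phi> \<in> dual_space (little_fock \<alpha>) \<Longrightarrow>
      bounded_Lp 1 (K1 * dual_norm (little_fock \<alpha>) \<phi>) (\<lambda>z. \<phi> (fock_kernel \<alpha> z))"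
    using little_fock_dual_L1[OF assms(1)] by blast
  show ?thesis
  proof (intro conjI allI impI)
    fix r :: ennreal assume r: "1 \<le> r"
    show "\<exists>c>0. \<forall>T\<in>nuclear_ops (little_fock \<alpha>) (fock \<alpha> s). berezin \<alpha> T \<in> Lr_space r \<and>
        Lr_norm r (berezin \<alpha> T) \<le> c * nuclear_norm (little_fock \<alpha>) (fock \<alpha> s) T"
      by (rule berezin_nuclear_bound[OF gauss_weighted_space_little_fock[OF assms(1)] _ assms(5) r K1])
         (use inv_le_1[OF r] in \<open>auto simp: inv intro: add_increasing2\<close>)
  next
    fix r :: ennreal assume pq: "p \<le> q" and r: "inverse (1 / p' + 1 / q) \<le> r"
    have "1 / p' + 1 / q \<le> 1 / p' + 1 / p"
      using inverse_ennreal_antimono[OF pq] by (simp add: inv)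
    then have "1 / p' + 1 / q \<le> 1" using assms(6) by (simp add: add.commute)
    then have "inverse 1 \<le> inverse (1 / p' + 1 / q)" by (rule inverse_ennreal_antimono)
    then have r1: "1 \<le> r" using r by simp
    have "inverse r \<le> inverse (inverse (1 / p' + 1 / q))"
      using r by (rule inverse_ennreal_antimono)
    then have arq: "1 / r \<le> 1 / p' + 1 / q" by (simp add: inv inverse_inverse_ennreal)
    show "\<exists>c>0. \<forall>T\<in>nuclear_ops (fock \<alpha> p) (fock \<alpha> q). berezin \<alpha> T \<in> Lr_space r \<and>
        Lr_norm r (berezin \<alpha> T) \<le> c * nuclear_norm (fock \<alpha> p) (fock \<alpha> q) T"
      by (rule berezin_nuclear_bound[OF X p' assms(4) r1 K arq])
  next
    fix r :: ennreal assume pq: "q < p" and r: "1 \<le> r"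
    have "1 / r \<le> 1 / p' + 1 / p"
      using inv_le_1[OF r] assms(6) by (simp add: add.commute)
    also have "\<dots> \<le> 1 / p' + 1 / q"
      using inverse_ennreal_antimono[of q p] pq by (simp add: inv)
    finally have arq: "1 / r \<le> 1 / p' + 1 / q" .
    show "\<exists>c>0. \<forall>T\<in>nuclear_ops (fock \<alpha> p) (fock \<alpha> q). berezin \<alpha> T \<in> Lr_space r \<and>
        Lr_norm r (berezin \<alpha> T) \<le> c * nuclear_norm (fock \<alpha> p) (fock \<alpha> q) T"
      by (rule berezin_nuclear_bound[OF X p' assms(4) r K arq])
  qed
qed

end
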